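(* Let $d\le 3$. Let $\mathcal{H}$ be a separable Hilbert space, let $\Lambda\simeq\mathbb{Z}^d\subset\mathbb{R}^d$ be a lattice, and let $\{P(k)\}_{k\in\mathbb{R}^d}\subset\mathcal{B}(\mathcal{H})$ be a family of orthogonal projectors of finite rank $m\in\mathbb{N}$ satisfying: (P1) the map $\mathbb{R}^d\ni k\mapsto P(k)\in\mathcal{B}(\mathcal{H})$ is $C^\infty$-smooth (operator norm); (P2) there is a unitary representation $\tau:\Lambda\to\mathcal{U}(\mathcal{H})$, $\lambda\mapsto\tau_\lambda$, such that $P(k+\lambda)=\tau_\lambda P(k)\tau_\lambda^{-1}$ for all $k\in\mathbb{R}^d$, $\lambda\in\Lambda$; (P3) there is an antiunitary operator $\Theta$ on $\mathcal{H}$ with $P(-k)=\Theta P(k)\Theta^{-1}$ for all $k$ and $\Theta^2=\mathrm{Id}_{\mathcal{H}}$; (P4) $\Theta\tau_\lambda=\tau_\lambda^{-1}\Theta$ for all $\lambda\in\Lambda$. Then there exist maps $\phi_1,\dots,\phi_m:\mathbb{R}^d\to\mathcal{H}$ such that: for every $k\in\mathbb{R}^d$, $\{\phi_1(k),\dots,\phi_m(k)\}$ is an orthonormal basis of $\operatorname{Ran}P(k)$; each $\phi_a$ is $C^\infty$-smooth; $\phi_a(k+\lambda)=\tau_\lambda\phi_a(k)$ for all $k\in\mathbb{R}^d$, $\lambda\in\Lambda$, $a\in\{1,\dots,m\}$; and $\phi_a(-k)=\Theta\phi_a(k)$ for all $k\in\mathbb{R}^d$, $a\in\{1,\dots,m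\}$.
   Context: An antiunitary operator is a surjective antilinear map $C:\mathcal{H}\to\mathcal{H}$ with $\langle C\phi,C\psi\rangle=\langle\psi,\phi\rangle$. A unitary representation satisfies $\tau_0=\mathrm{Id}$ and $\tau_{\lambda_1+\lambda_2}=\tau_{\lambda_1}\tau_{\lambda_2}$. (In the paper's terminology the conclusion says there exists a global smooth symmetric Bloch frame, i.e. a smooth, $\tau$-equivariant and time-reversal invariant one.) *)

theory Defs
  imports "HOL-Analysis.Analysis"
begin

text \<open>A complex Hilbert space is modelled as its realification: a real Hilbert space
  'h (class real_inner + complete_space) together with a complex structure J
  (multiplication by i): J real-linear, J (J x) = - x, J orthogonal.\<close>

definition complex_structure :: "('h::real_inner \<Rightarrow> 'h) \<Rightarrow> bool" where
  "complex_structure J \<longleftrightarrow> linear J \<and> (\<forall>x. J (J x) = - x) \<and> (\<forall>x y. J x \<bullet> J y = x \<bullet> y)"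

definition cscale :: "('h::real_inner \<Rightarrow> 'h) \<Rightarrow> complex \<Rightarrow> 'h \<Rightarrow> 'h" where
  "cscale J z x = Re z *\<^sub>R x + Im z *\<^sub>R J x"

text \<open>Complex inner product, antilinear in the first and linear in the second argument;
  its real part is the real inner product.\<close>
definition cinner :: "('h::real_inner \<Rightarrow> 'h) \<Rightarrow> 'h \<Rightarrow> 'h \<Rightarrow> complex" where
  "cinner J x y = Complex (x \<bullet> y) (J x \<bullet> y)"

definition clinear :: "('h::real_inner \<Rightarrow> 'h) \<Rightarrow> ('h \<Rightarrow> 'h) \<Rightarrow> bool" where
  "clinear J T \<longleftrightarrow> linear T \<and> (\<forall>x. T (J x) = J (T x))"

definition cantilinear :: "('h::real_inner \<Rightarrow> 'h) \<Rightarrow> ('h \<Rightarrow> 'h) \<Rightarrow> bool" where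
  "cantilinear J T \<longleftrightarrow> linear T \<and> (\<forall>x. T (J x) = - J (T x))"

definition cspan :: "('h::real_inner \<Rightarrow> 'h) \<Rightarrow> 'h set \<Rightarrow> 'h set" where
  "cspan J S = {x. \<exists>F c. finite F \<and> F \<subseteq> S \<and> x = (\<Sum>v\<in>F. cscale J (c v) v)}"

definition cindependent :: "('h::real_inner \<Rightarrow> 'h) \<Rightarrow> 'h set \<Rightarrow> bool" where
  "cindependent J S \<longleftrightarrow>
     (\<forall>F c. finite F \<and> F \<subseteq> S \<and> (\<Sum>v\<in>F. cscale J (c v) v) = 0 \<longrightarrow> (\<forall>v\<in>F. c v = 0))"

definition cdim_eq :: "('h::real_inner \<Rightarrow> 'h) \<Rightarrow> 'h set \<Rightarrow> nat \<Rightarrow> bool" where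
  "cdim_eq J V m \<longleftrightarrow> (\<exists>B. finite B \<and> card B = m \<and> cindependent J B \<and> cspan J B = V)"

definition orth_projector :: "('h::real_inner \<Rightarrow> 'h) \<Rightarrow> ('h \<Rightarrow> 'h) \<Rightarrow> bool" where
  "orth_projector J P \<longleftrightarrow> clinear J P \<and> P \<circ> P = P \<and> (\<forall>x y. cinner J (P x) y = cinner J x (P y))"

definition unitary_op :: "('h::real_inner \<Rightarrow> 'h) \<Rightarrow> ('h \<Rightarrow> 'h) \<Rightarrow> bool" where
  "unitary_op J U \<longleftrightarrow> clinear J U \<and> surj U \<and> (\<forall>x y. cinner J (U x) (U y) = cinner J x y)"

definition antiunitary_op :: "('h::real_inner \<Rightarrow> 'h) \<Rightarrow> ('h \<Rightarrow> 'h) \<Rightarrow> bool" where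
  "antiunitary_op J C \<longleftrightarrow> cantilinear J C \<and> surj C \<and> (\<forall>x y. cinner J (C x) (C y) = cinner J y x)"

text \<open>C-infinity smoothness on a finite-dimensional real domain: f is differentiable
  everywhere and every directional derivative x \<mapsto> f'(x) v is again smooth (coinductively,
  i.e. derivatives of all orders exist).\<close>
coinductive smooth_map :: "('a::euclidean_space \<Rightarrow> 'b::real_normed_vector) \<Rightarrow> bool" where
  "\<lbrakk>\<And>x. (f has_derivative f' x) (at x); \<And>v. smooth_map (\<lambda>x. f' x v)\<rbrakk> \<Longrightarrow> smooth_map f"

definition lattice_of :: "real^'d^'d \<Rightarrow> (real^'d) set" where
  "lattice_of B = range (\<lambda>n::'d \<Rightarrow> int. B *v (\<chi> i. of_int (n i)))"

end

theory Submission
  imports Defs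
begin

text \<open>
  It suffices to find one smooth symmetric unit section \<open>\<phi>\<close> of \<open>Ran P\<close>: replacing \<open>P\<close> by
  \<open>P - |\<phi>\<rangle>\<langle>\<phi>|\<close> lowers the rank by one, and one iterates. After a linear change of coordinates the
  lattice is \<open>\<int>\<^sup>d\<close>.

  If the rank is at least 2, start from the zero section and remove its zeros by small perturbations.
  At a point fixed by \<open>k \<mapsto> -k\<close> modulo the lattice, a small multiple of a real section is added.
  Near any other point, two free complex parameters \<open>(c\<^sub>1, c\<^sub>2)\<close> are available, and those that leave a zero
  lie in the image of a differentiable map from \<open>\<real>\<^sup>d\<close> to \<open>\<complex>\<^sup>2\<close>, a null set because \<open>d \<le> 3 < 4\<close>.
  Finitely many such steps cover the unit cube.

  If the rank is 1, a continuous symmetric section is built one coordinate at a time by discrete parallel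
  transport over the cell \<open>-1/2 \<le> t \<le> 1/2\<close>. The mismatch between the two ends is a phase
  \<open>\<alpha>\<close> that time reversal forces to be even. A logarithm \<open>\<theta>\<close> of \<open>\<alpha>\<close> is then even too, hence periodic
  (compare \<open>\<theta>(l/2)\<close> with \<open>\<theta>(-l/2)\<close>), and multiplication by \<open>exp(i t \<theta>)\<close> closes the section up.
  Averaging with bump functions makes it smooth.
\<close>

section \<open>Calculus of smooth maps\<close>

text \<open>Finite-order counterpart of \<open>smooth_map\<close>. Closure properties are proved by
  induction on the order and carried over through \<open>smooth_map_iff_Ck\<close>, which avoids a
  coinduction for each of them.\<close>

primrec Ck :: "nat \<Rightarrow> ('a::euclidean_space \<Rightarrow> 'b::real_normed_vector) \<Rightarrow> bool" where
  "Ck 0 f \<longleftrightarrow> True"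
| "Ck (Suc n) f \<longleftrightarrow> (\<exists>f'. (\<forall>x. (f has_derivative f' x) (at x)) \<and> (\<forall>v. Ck n (\<lambda>x. f' x v)))"

lemma smooth_map_Ck: "smooth_map f \<Longrightarrow> Ck n f"
proof (induction n arbitrary: f)
  case (Suc n)
  from Suc.prems obtain f' where "\<And>x. (f has_derivative f' x) (at x)"
    and "\<And>v. smooth_map (\<lambda>x. f' x v)"
    by (cases rule: smooth_map.cases) blast
  then show ?case using Suc.IH by auto
qed simp

text \<open>Each order supplies its own derivative. Uniqueness of derivatives identifies them all
  with one \<open>f'\<close>, and this is the witness that the coinduction needs.\<close>

lemma Ck_smooth_map:
  assumes "\<And>n. Ck n f"
  shows "smooth_map f"
proof -
  have "\<forall>n. Ck n f" using assms by simp
  then show ?thesis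
  proof (coinduction arbitrary: f)
    case smooth_map
    from smooth_map have "Ck (Suc 0) f" by blast
    then obtain f' where f': "\<And>x. (f has_derivative f' x) (at x)" by auto
    have "Ck n (\<lambda>x. f' x v)" for n v
    proof -
      from smooth_map have "Ck (Suc n) f" by blast
      then obtain f'' where f'': "\<And>x. (f has_derivative f'' x) (at x)" "Ck n (\<lambda>x. f'' x v)" by auto
      have "f'' x = f' x" for x by (rule has_derivative_unique[OF f''(1) f'])
      then show ?thesis using f''(2) by simp
    qed
    then show ?case using f' by blast
  qed
qed

lemma smooth_map_iff_Ck: "smooth_map f \<longleftrightarrow> (\<forall>n. Ck n f)"
  using smooth_map_Ck Ck_smooth_map by blast

lemma Ck_SucD: "Ck (Suc n) f \<Longrightarrow> Ck n f"
proof (induction n arbitrary: f)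
  case (Suc n)
  then obtain f' where "\<forall>x. (f has_derivative f' x) (at x)" "\<forall>v. Ck (Suc n) (\<lambda>x. f' x v)"
    by (metis Ck.simps(2))
  then show ?case using Suc.IH by auto
qed simp

lemma Ck_const: "Ck n (\<lambda>x. c)"
proof (induction n arbitrary: c)
  case (Suc n)
  show ?case unfolding Ck.simps by (intro exI[of _ "\<lambda>x v. 0"]) (auto intro!: derivative_eq_intros Suc)
qed simp

lemma Ck_add: "Ck n f \<Longrightarrow> Ck n g \<Longrightarrow> Ck n (\<lambda>x. f x + g x)"
proof (induction n arbitrary: f g)
  case (Suc n)
  from Suc.prems obtain f' g' where *: "\<forall>x. (f has_derivative f' x) (at x)" "\<forall>v. Ck n (\<lambda>x. f' x v)"
    "\<forall>x. (g has_derivative g' x) (at x)" "\<forall>v. Ck n (\<lambda>x. g' x v)" by auto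
  show ?case unfolding Ck.simps
    by (intro exI[of _ "\<lambda>x v. f' x v + g' x v"]) (use * in \<open>auto intro!: has_derivative_add Suc.IH\<close>)
qed simp

lemma Ck_bounded_linear:
  assumes "bounded_linear h"
  shows "Ck n f \<Longrightarrow> Ck n (\<lambda>x. h (f x))"
proof (induction n arbitrary: f)
  case (Suc n)
  from Suc.prems obtain f' where *: "\<forall>x. (f has_derivative f' x) (at x)" "\<forall>v. Ck n (\<lambda>x. f' x v)" by auto
  show ?case unfolding Ck.simps
    by (intro exI[of _ "\<lambda>x v. h (f' x v)"])
      (use * in \<open>auto intro!: bounded_linear.has_derivative[OF assms] Suc.IH\<close>)
qed simp

lemma Ck_bilinear:
  assumes "bounded_bilinear B"
  shows "Ck n f \<Longrightarrow> Ck n g \<Longrightarrow> Ck n (\<lambda>x. B (f x) (g x))"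
proof (induction n arbitrary: f g)
  case (Suc n)
  from Suc.prems obtain f' g' where *: "\<forall>x. (f has_derivative f' x) (at x)" "\<forall>v. Ck n (\<lambda>x. f' x v)"
    "\<forall>x. (g has_derivative g' x) (at x)" "\<forall>v. Ck n (\<lambda>x. g' x v)" by auto
  show ?case unfolding Ck.simps
    by (intro exI[of _ "\<lambda>x v. B (f x) (g' x v) + B (f' x v) (g x)"])
      (use * Suc.prems in \<open>auto intro!: bounded_bilinear.FDERIV[OF assms] Ck_add Suc.IH Ck_SucD[OF Suc.prems(1)] Ck_SucD[OF Suc.prems(2)]\<close>)
qed simp

lemma Ck_affine:
  fixes L :: "'a::euclidean_space \<Rightarrow> 'b::euclidean_space"
  assumes "linear L"
  shows "Ck n f \<Longrightarrow> Ck n (\<lambda>x. f (L x + b))"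
proof (induction n arbitrary: f)
  case (Suc n)
  from Suc.prems obtain f' where *: "\<forall>x. (f has_derivative f' x) (at x)" "\<forall>v. Ck n (\<lambda>x. f' x v)" by auto
  have L: "((\<lambda>x. L x + b) has_derivative L) (at x)" for x
    using assms by (auto intro!: derivative_eq_intros linear_imp_has_derivative)
  show ?case unfolding Ck.simps
  proof (intro exI[of _ "\<lambda>x v. f' (L x + b) (L v)"] conjI allI)
    fix x
    show "((\<lambda>x. f (L x + b)) has_derivative (\<lambda>v. f' (L x + b) (L v))) (at x)"
      by (rule has_derivative_compose[OF L]) (use * in auto)
  next
    fix v show "Ck n (\<lambda>x. f' (L x + b) (L v))"
      using Suc.IH[of "\<lambda>y. f' y (L v)"] * by auto
  qed
qed simp

text \<open>At each point the derivative is taken from the local representative chosen there. On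
  \<open>U x\<close> uniqueness makes it agree with the derivative of the single map
  \<open>g x\<close>, so the directional derivatives again satisfy the hypothesis one order
  lower.\<close>

lemma Ck_locally:
  assumes "\<And>x. \<exists>U g. open U \<and> x \<in> U \<and> (\<forall>y\<in>U. f y = g y) \<and> Ck n g"
  shows "Ck n f"
  using assms
proof (induction n arbitrary: f)
  case (Suc n)
  from Suc.prems have "\<forall>x. \<exists>U g. open U \<and> x \<in> U \<and> (\<forall>y\<in>U. f y = g y) \<and> Ck (Suc n) g" by blast
  then obtain U g where Ug: "\<And>x. open (U x)" "\<And>x. x \<in> U x" "\<And>x y. y \<in> U x \<Longrightarrow> f y = g x y"
      "\<And>x. Ck (Suc n) (g x)"
    by metis
  have "\<forall>x. \<exists>g'. (\<forall>y. (g x has_derivative g' y) (at y)) \<and> (\<forall>v. Ck n (\<lambda>y. g' y v))"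
    using Ug(4) by simp
  then obtain g' where g': "\<And>x y. (g x has_derivative g' x y) (at y)" "\<And>x v. Ck n (\<lambda>y. g' x y v)"
    by metis
  have der: "(f has_derivative g' x y) (at y)" if "y \<in> U x" for x y
    by (rule has_derivative_transform_within_open[OF g'(1) Ug(1) that]) (simp add: Ug(3))
  have loc: "g' y y = g' x y" if "y \<in> U x" for x y
    by (rule has_derivative_unique[OF der[OF Ug(2)] der[OF that]])
  show ?case unfolding Ck.simps
  proof (intro exI[of _ "\<lambda>x. g' x x"] conjI allI)
    fix x show "(f has_derivative g' x x) (at x)" by (rule der[OF Ug(2)])
  next
    fix v show "Ck n (\<lambda>x. g' x x v)"
    proof (rule Suc.IH)
      fix x
      show "\<exists>V h. open V \<and> x \<in> V \<and> (\<forall>y\<in>V. g' y y v = h y) \<and> Ck n h"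
        using Ug(1)[of x] Ug(2)[of x] loc[of _ x] g'(2)[of x v] by (intro exI[of _ "U x"] exI[of _ "\<lambda>y. g' x y v"]) simp
    qed
  qed
qed simp

text \<open>The induction runs over all exponents at once because differentiation lowers the
  exponent by one.\<close>

lemma Ck_powr:
  fixes f :: "'a::euclidean_space \<Rightarrow> real"
  assumes pos: "\<And>x. f x > 0"
  shows "Ck n f \<Longrightarrow> Ck n (\<lambda>x. f x powr a)"
proof (induction n arbitrary: a)
  case (Suc n)
  from Suc.prems obtain f' where *: "\<forall>x. (f has_derivative f' x) (at x)" "\<forall>v. Ck n (\<lambda>x. f' x v)" by auto
  show ?case unfolding Ck.simps
  proof (intro exI[of _ "\<lambda>x v. (a * f x powr (a - 1)) * f' x v"] conjI allI)
    fix x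
    have "((\<lambda>y. y powr a) has_real_derivative a * f x powr (a - 1)) (at (f x))"
      using pos by (rule has_real_derivative_powr)
    then have "((\<lambda>y. y powr a) has_derivative (*) (a * f x powr (a - 1))) (at (f x))"
      by (simp add: has_field_derivative_def)
    then show "((\<lambda>x. f x powr a) has_derivative (\<lambda>v. a * f x powr (a - 1) * f' x v)) (at x)"
      using has_derivative_compose[of f "f' x" x UNIV] * by blast
  next
    fix v
    have "Ck n (\<lambda>x. f x powr (a - 1))" using Suc.IH Ck_SucD[OF Suc.prems] by blast
    then show "Ck n (\<lambda>x. a * f x powr (a - 1) * f' x v)"
      using * by (intro Ck_bilinear[OF bounded_bilinear_mult] Ck_const) auto
  qed
qed simp

lemma Ck_compose_real:
  fixes f :: "'a::euclidean_space \<Rightarrow> real" and h :: "real \<Rightarrow> real"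
  shows "Ck n h \<Longrightarrow> Ck n f \<Longrightarrow> Ck n (\<lambda>x. h (f x))"
proof (induction n arbitrary: h)
  case (Suc n)
  from Suc.prems obtain f' h' where *: "\<forall>x. (f has_derivative f' x) (at x)" "\<forall>v. Ck n (\<lambda>x. f' x v)"
    "\<forall>x. (h has_derivative h' x) (at x)" "\<forall>v. Ck n (\<lambda>x. h' x v)" by auto
  \<comment> \<open>On the real line a derivative is determined by its value in direction 1. The
    chain rule thus becomes a product of a derivative of \<open>f\<close> and a composition covered
    by the induction hypothesis.\<close>
  have lin: "h' y v = v * h' y 1" for y v
  proof -
    have "linear (h' y)" using *(3) has_derivative_linear by blast
    then have "h' y (v *\<^sub>R 1) = v *\<^sub>R h' y 1" by (rule linear_cmul)
    then show ?thesis by simp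
  qed
  show ?case unfolding Ck.simps
  proof (intro exI[of _ "\<lambda>x v. f' x v * h' (f x) 1"] conjI allI)
    fix x
    have "((\<lambda>x. h (f x)) has_derivative (\<lambda>v. h' (f x) (f' x v))) (at x)"
      using has_derivative_compose[of f "f' x" x UNIV h "h' (f x)"] * by blast
    then show "((\<lambda>x. h (f x)) has_derivative (\<lambda>v. f' x v * h' (f x) 1)) (at x)"
      by (subst (asm) lin)
  next
    fix v
    have "Ck n (\<lambda>x. h' (f x) 1)" 
      using Suc.IH[of "\<lambda>y. h' y 1"] * Ck_SucD[OF Suc.prems(2)] by auto
    then show "Ck n (\<lambda>x. f' x v * h' (f x) 1)"
      using * by (intro Ck_bilinear[OF bounded_bilinear_mult]) auto
  qed
qed simp

lemma smooth_map_const: "smooth_map (\<lambda>x. c)"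
  by (simp add: smooth_map_iff_Ck Ck_const)

lemma smooth_map_add: "smooth_map f \<Longrightarrow> smooth_map g \<Longrightarrow> smooth_map (\<lambda>x. f x + g x)"
  by (simp add: smooth_map_iff_Ck Ck_add)

lemma smooth_map_bounded_linear: "bounded_linear h \<Longrightarrow> smooth_map f \<Longrightarrow> smooth_map (\<lambda>x. h (f x))"
  by (simp add: smooth_map_iff_Ck Ck_bounded_linear)

lemma smooth_map_bilinear:
  "bounded_bilinear B \<Longrightarrow> smooth_map f \<Longrightarrow> smooth_map g \<Longrightarrow> smooth_map (\<lambda>x. B (f x) (g x))"
  by (simp add: smooth_map_iff_Ck Ck_bilinear)

lemmas smooth_map_scaleR = smooth_map_bilinear[OF bounded_bilinear_scaleR]
lemmas smooth_map_inner = smooth_map_bilinear[OF bounded_bilinear_inner]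

lemma smooth_map_diff: "smooth_map f \<Longrightarrow> smooth_map g \<Longrightarrow> smooth_map (\<lambda>x. f x - g x)"
  using smooth_map_add[of f "\<lambda>x. - g x"] smooth_map_bounded_linear[OF bounded_linear_minus[OF bounded_linear_ident], of g]
  by simp

lemma smooth_map_sum: "(\<And>i. i \<in> I \<Longrightarrow> smooth_map (f i)) \<Longrightarrow> smooth_map (\<lambda>x. \<Sum>i\<in>I. f i x)"
  by (induction I rule: infinite_finite_induct) (auto intro: smooth_map_const smooth_map_add)

lemma smooth_map_affine:
  "linear L \<Longrightarrow> smooth_map f \<Longrightarrow> smooth_map (\<lambda>x. f (L x + b))"
  by (simp add: smooth_map_iff_Ck Ck_affine)

lemma smooth_map_linear_compose: "linear L \<Longrightarrow> smooth_map f \<Longrightarrow> smooth_map (\<lambda>x. f (L x))"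
  using smooth_map_affine[of L f 0] by simp

lemma smooth_map_shift: "smooth_map f \<Longrightarrow> smooth_map (\<lambda>x. f (x - b))"
  using smooth_map_affine[of "\<lambda>x. x" f "- b"] by (simp add: linear_ident)

lemma smooth_map_reflect: "smooth_map f \<Longrightarrow> smooth_map (\<lambda>x. f (- x))"
  using smooth_map_affine[of uminus f 0] by (simp add: linear_uminus)

lemma smooth_map_locally:
  assumes "\<And>x. \<exists>U g. open U \<and> x \<in> U \<and> (\<forall>y\<in>U. f y = g y) \<and> smooth_map g"
  shows "smooth_map f"
proof (rule Ck_smooth_map, rule Ck_locally)
  fix n x
  show "\<exists>U g. open U \<and> x \<in> U \<and> (\<forall>y\<in>U. f y = g y) \<and> Ck n g"
    using assms[of x] smooth_map_Ck by blast
qed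

lemma smooth_map_powr:
  fixes f :: "'a::euclidean_space \<Rightarrow> real"
  shows "(\<And>x. f x > 0) \<Longrightarrow> smooth_map f \<Longrightarrow> smooth_map (\<lambda>x. f x powr a)"
  by (simp add: smooth_map_iff_Ck Ck_powr)

lemma smooth_map_differentiable: "smooth_map f \<Longrightarrow> f differentiable (at x)"
  by (auto elim!: smooth_map.cases simp: differentiable_def)

lemma smooth_map_continuous: "smooth_map f \<Longrightarrow> continuous_on S f"
  using smooth_map_differentiable differentiable_imp_continuous_within continuous_at_imp_continuous_on by blast

lemma smooth_map_ident: "smooth_map (\<lambda>x. x)"
proof (rule Ck_smooth_map)
  fix n show "Ck n (\<lambda>x::'a. x)"
    by (cases n) (auto intro!: exI[of _ "\<lambda>x v. v"] Ck_const)
qed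

section \<open>Smooth bump functions\<close>

definition flat_exp :: "nat \<Rightarrow> real \<Rightarrow> real" where
  "flat_exp n x = (if x > 0 then exp (- (1/x)) / x ^ n else 0)"

text \<open>For positive \<open>x\<close>, compare the exponential series at \<open>1/x\<close> with
  its single term of order \<open>n + 2\<close>. The quadratic decay is what forces the difference
  quotient at the origin to vanish.\<close>

lemma flat_exp_bound: "\<bar>flat_exp n x\<bar> \<le> fact (n + 2) * x\<^sup>2"
proof (cases "x > 0")
  case True
  have "(1/x) ^ (n+2) / fact (n+2) \<le> exp (1/x)"
  proof -
    have "(1/x)^(n+2) /\<^sub>R fact (n+2) = (\<Sum>k\<in>{n+2}. (1/x)^k /\<^sub>R fact k)" by simp
    also have "\<dots> \<le> (\<Sum>k. (1/x)^k /\<^sub>R fact k)"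
      using True by (intro sum_le_suminf summable_exp_generic) auto
    also have "\<dots> = exp (1/x)" by (simp add: exp_def)
    finally show ?thesis by (simp add: field_simps)
  qed
  then have "exp (- (1/x)) * (1/x)^(n+2) \<le> fact (n+2)"
  proof -
    have "(1/x)^(n+2) \<le> fact (n+2) * exp (1/x)"
      using \<open>(1/x) ^ (n+2) / fact (n+2) \<le> exp (1/x)\<close>
      by (simp only: pos_divide_le_eq[OF fact_gt_zero] mult.commute)
    then have "exp (- (1/x)) * (1/x)^(n+2) \<le> exp (- (1/x)) * (fact (n+2) * exp (1/x))"
      by (rule mult_left_mono) simp
    also have "\<dots> = fact (n+2) * (exp (- (1/x)) * exp (1/x))" by (simp only: ac_simps)
    also have "\<dots> = fact (n+2)" by (simp flip: exp_add del: fact_Suc)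
    finally show ?thesis .
  qed
  then have "exp (- (1/x)) / x^n * (1/x\<^sup>2) \<le> fact (n+2)"
    using True by (simp add: power_add power_divide power2_eq_square mult_ac)
  then show ?thesis using True by (simp add: flat_exp_def field_simps)
qed (simp add: flat_exp_def)

text \<open>The denominators \<open>x ^ n\<close> make the family closed under differentiation up to
  linear combinations, so smoothness of all members follows by one induction on the order.\<close>

lemma flat_exp_deriv: "(flat_exp n has_real_derivative (flat_exp (n+2) x - real n * flat_exp (n+1) x)) (at x)"
proof -
  consider "x > 0" | "x < 0" | "x = 0" by linarith
  then show ?thesis
  proof cases
    case 1
    have "((\<lambda>x. exp (- (1/x)) / x ^ n) has_real_derivative (flat_exp (n+2) x - real n * flat_exp (n+1) x)) (at x)"
      using 1 by (auto intro!: derivative_eq_intros simp: flat_exp_def field_simps power_add power2_eq_square)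
        (cases n; simp add: field_simps)
    then show ?thesis
      by (rule has_field_derivative_transform_within_open[of _ _ _ "{0<..}"]) (use 1 in \<open>auto simp: flat_exp_def\<close>)
  next
    case 2
    have "((\<lambda>x. 0) has_real_derivative (flat_exp (n+2) x - real n * flat_exp (n+1) x)) (at x)"
      using 2 by (auto intro!: derivative_eq_intros simp: flat_exp_def)
    then show ?thesis
      by (rule has_field_derivative_transform_within_open[of _ _ _ "{..<0}"]) (use 2 in \<open>auto simp: flat_exp_def\<close>)
  next
    case 3
    have "((\<lambda>y. flat_exp n y / y) \<longlongrightarrow> 0) (at 0)"
    proof (rule tendsto_0_le[where K=1 and f = "\<lambda>y. fact (n+2) * y"])
      show "((\<lambda>y::real. fact (n+2) * y) \<longlongrightarrow> 0) (at 0)"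
        by (auto intro!: tendsto_eq_intros)
      show "\<forall>\<^sub>F y in at 0. norm (flat_exp n y / y) \<le> norm (fact (n+2) * y) * 1"
      proof (rule eventually_mono[OF eventually_at_filter[THEN iffD2]])
        show "\<forall>\<^sub>F y in nhds (0::real). y \<noteq> 0 \<longrightarrow> y \<in> UNIV \<longrightarrow> y \<noteq> 0" by simp
        fix y :: real assume "y \<noteq> 0"
        then show "norm (flat_exp n y / y) \<le> norm (fact (n+2) * y) * 1"
          using flat_exp_bound[of n y]
          by (simp add: abs_mult abs_divide divide_le_eq power2_eq_square)
      qed
    qed
    then show ?thesis using 3 by (simp add: has_field_derivative_iff flat_exp_def)
  qed
qed

lemma smooth_map_flat_exp: "smooth_map (flat_exp n)"
proof (rule Ck_smooth_map)
  fix k show "Ck k (flat_exp n)"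
  proof (induction k arbitrary: n)
    case (Suc k)
    show ?case unfolding Ck.simps
    proof (intro exI[of _ "\<lambda>x v. (flat_exp (n+2) x + (- real n) * flat_exp (n+1) x) * v"] conjI allI)
      fix x show "(flat_exp n has_derivative (\<lambda>v. (flat_exp (n+2) x + (- real n) * flat_exp (n+1) x) * v)) (at x)"
        using flat_exp_deriv[of n x] by (simp add: has_field_derivative_def)
      fix v show "Ck k (\<lambda>x. (flat_exp (n+2) x + (- real n) * flat_exp (n+1) x) * v)"
        by (intro Ck_bilinear[OF bounded_bilinear_mult] Ck_add Ck_const Suc)
    qed
  qed simp
qed

text \<open>The squared distance is used because, unlike the norm, it is smooth at the centre
  \<open>q\<close>.\<close>

definition bump :: "'a::euclidean_space \<Rightarrow> real \<Rightarrow> 'a \<Rightarrow> real" where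
  "bump q r x = flat_exp 0 (r\<^sup>2 - (x - q) \<bullet> (x - q))"

lemma smooth_map_bump: "smooth_map (bump q r)"
proof -
  have "smooth_map (\<lambda>x::'a. r\<^sup>2 - (x - q) \<bullet> (x - q))"
    by (intro smooth_map_diff smooth_map_const smooth_map_inner smooth_map_ident)
  then show ?thesis
    unfolding bump_def[abs_def] smooth_map_iff_Ck
    using Ck_compose_real smooth_map_flat_exp smooth_map_Ck by blast
qed

lemma bump_nonneg: "bump q r x \<ge> 0"
  by (simp add: bump_def flat_exp_def)

lemma bump_le_1: "bump q r x \<le> 1"
  by (auto simp: bump_def flat_exp_def)

lemma bump_pos_iff: "r > 0 \<Longrightarrow> bump q r x > 0 \<longleftrightarrow> dist q x < r"
  using power_mono_iff[of r "norm (x - q)" 2]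
  by (auto simp: bump_def flat_exp_def dist_norm norm_minus_commute[of q] not_le[symmetric] simp flip: power2_norm_eq_inner)

lemma bump_eq_0_iff: "r > 0 \<Longrightarrow> bump q r x = 0 \<longleftrightarrow> dist q x \<ge> r"
  using bump_pos_iff[of r q x] bump_nonneg[of q r x] by linarith

section \<open>Complex structures and orthogonal projectors\<close>

locale complex_hilbert =
  fixes J :: "'h::real_inner \<Rightarrow> 'h"
  assumes J: "complex_structure J"
begin

lemma linear_J: "linear J" and J_J [simp]: "J (J x) = - x" and J_inner_J [simp]: "J x \<bullet> J y = x \<bullet> y"
  using J by (auto simp: complex_structure_def)

lemmas J_simps [simp] = linear_0[OF linear_J] linear_add[OF linear_J] linear_diff[OF linear_J]
  linear_scale[OF linear_J] linear_neg[OF linear_J] linear_sum[OF linear_J]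

lemma norm_J [simp]: "norm (J x) = norm x"
  by (simp add: norm_eq_sqrt_inner)

lemma bounded_linear_J: "bounded_linear J"
  by (rule bounded_linear_intro[where K=1]) auto

lemma J_inner_left: "J x \<bullet> y = - (x \<bullet> J y)"
  using J_inner_J[of x "J y"] by simp

lemma J_inner_self [simp]: "J x \<bullet> x = 0" "x \<bullet> J x = 0"
  using J_inner_left[of x x] by (simp_all add: inner_commute)

lemma cinner_commute: "cinner J y x = cnj (cinner J x y)"
  using J_inner_left[of y x] by (simp add: cinner_def complex_eq_iff inner_commute)

lemma cinner_self: "cinner J x x = of_real ((norm x)\<^sup>2)"
  by (simp add: cinner_def complex_eq_iff power2_norm_eq_inner)

lemma cinner_add_right: "cinner J x (y + z) = cinner J x y + cinner J x z"
  by (simp add: cinner_def complex_eq_iff inner_add_right)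

lemma cinner_diff_right: "cinner J x (y - z) = cinner J x y - cinner J x z"
  by (simp add: cinner_def complex_eq_iff inner_diff_right)

lemma cinner_diff_left: "cinner J (x - y) z = cinner J x z - cinner J y z"
  by (simp add: cinner_def complex_eq_iff inner_diff_left)

lemma cinner_cscale_right: "cinner J x (cscale J z y) = z * cinner J x y"
  by (simp add: cinner_def cscale_def complex_eq_iff inner_add_right algebra_simps J_inner_left)

lemma cinner_cscale_left: "cinner J (cscale J z x) y = cnj z * cinner J x y"
  by (subst (1 2) cinner_commute) (simp add: cinner_cscale_right)

lemma cinner_0 [simp]: "cinner J x 0 = 0" "cinner J 0 x = 0"
  by (auto simp: cinner_def complex_eq_iff)

lemma cscale_simps [simp]: "cscale J 1 x = x" "cscale J 0 x = 0" "cscale J z 0 = 0"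
  by (auto simp: cscale_def)

lemma cscale_cscale: "cscale J a (cscale J b x) = cscale J (a * b) x"
  by (simp add: cscale_def algebra_simps)

lemma norm_cscale: "norm (cscale J z x) = cmod z * norm x"
proof -
  have "cscale J z x \<bullet> cscale J z x = (cmod z)\<^sup>2 * (x \<bullet> x)"
    unfolding cmod_power2 by (simp add: cscale_def inner_add_left inner_add_right power2_eq_square algebra_simps)
  then show ?thesis
    by (simp add: norm_eq_sqrt_inner real_sqrt_mult)
qed

lemma bounded_linear_cinner: "bounded_linear (cinner J x)"
proof -
  have "cinner J x = (\<lambda>y. of_real (x \<bullet> y) + of_real (J x \<bullet> y) * \<i>)"
    by (simp add: fun_eq_iff cinner_def complex_eq_iff)
  moreover have "bounded_linear (\<lambda>y. complex_of_real (x \<bullet> y) + of_real (J x \<bullet> y) * \<i>)"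
    by (intro bounded_linear_add bounded_linear_compose[OF bounded_linear_of_real]
        bounded_linear_compose[OF bounded_linear_mult_left] bounded_linear_inner_right)
  ultimately show ?thesis by simp
qed

lemma continuous_on_cinner:
  assumes "continuous_on S f" "continuous_on S g"
  shows "continuous_on S (\<lambda>x. cinner J (f x) (g x))"
proof -
  have "(\<lambda>x. cinner J (f x) (g x)) = (\<lambda>x. of_real (f x \<bullet> g x) + of_real (J (f x) \<bullet> g x) * \<i>)"
    by (simp add: fun_eq_iff cinner_def complex_eq_iff)
  then show ?thesis
    by (simp only:) (intro continuous_intros bounded_linear.continuous_on[OF bounded_linear_J] assms)
qed

lemma continuous_on_cscale:
  assumes "continuous_on S f" "continuous_on S g"
  shows "continuous_on S (\<lambda>x. cscale J (f x) (g x))"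
  unfolding cscale_def by (intro continuous_intros bounded_linear.continuous_on[OF bounded_linear_J] assms)

text \<open>This makes the abstract theory of span and independence over the complex numbers
  available for counting ranks.\<close>

sublocale C: vector_space "cscale J"
  by unfold_locales (auto simp: cscale_def algebra_simps)

lemma cspan_eq_span: "cspan J S = C.span S"
  by (auto simp: cspan_def C.span_explicit)

lemma cindependent_iff: "cindependent J S \<longleftrightarrow> C.independent S"
  by (auto simp: cindependent_def C.independent_explicit_module)

lemma orth_projector_simps:
  assumes "orth_projector J Q"
  shows "linear Q" "Q (J x) = J (Q x)" "Q (Q x) = Q x" "Q x \<bullet> y = x \<bullet> Q y"
    "cinner J (Q x) y = cinner J x (Q y)" "Q (cscale J z x) = cscale J z (Q x)"
    "norm (Q x) \<le> norm x"
proof -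
  show l: "linear Q" and JQ: "\<And>x. Q (J x) = J (Q x)" and
    c: "\<And>x y. cinner J (Q x) y = cinner J x (Q y)"
    using assms by (auto simp: orth_projector_def clinear_def)
  show QQ: "Q (Q x) = Q x" for x
    using assms by (metis comp_apply orth_projector_def)
  show i: "Q x \<bullet> y = x \<bullet> Q y" for x y
    using c[of x y] by (simp add: cinner_def)
  show "Q (cscale J z x) = cscale J z (Q x)"
    by (simp add: cscale_def linear_add[OF l] linear_scale[OF l] JQ)
  have "norm (Q x) * norm (Q x) = x \<bullet> Q x"
    using i[of x "Q x"] QQ by (simp flip: power2_norm_eq_inner add: power2_eq_square)
  also have "\<dots> \<le> norm x * norm (Q x)" by (rule norm_cauchy_schwarz)
  finally show "norm (Q x) \<le> norm x"
    by (metis mult_right_le_imp_le norm_ge_zero order_le_less)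
qed

lemma range_projector: "orth_projector J Q \<Longrightarrow> x \<in> range Q \<longleftrightarrow> Q x = x"
  by (metis orth_projector_simps(3) rangeE rangeI)

text \<open>For a unit vector \<open>u\<close> this is the orthogonal projector onto the complex
  line through \<open>u\<close>.\<close>

definition dyad :: "'h \<Rightarrow> 'h \<Rightarrow> 'h" where
  "dyad u x = cscale J (cinner J u x) u"

lemma dyad_eq: "dyad u x = (u \<bullet> x) *\<^sub>R u + (J u \<bullet> x) *\<^sub>R J u"
  by (simp add: dyad_def cscale_def cinner_def)

lemma linear_dyad: "linear (dyad u)"
  by (rule linearI) (simp_all add: dyad_eq inner_add_right algebra_simps)

lemma dyad_self: "norm u = 1 \<Longrightarrow> dyad u u = u"
  by (simp add: dyad_def cinner_self)

text \<open>Since the self-adjoint \<open>Q\<close> fixes \<open>u\<close>, composing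
  \<open>Q\<close> with \<open>dyad u\<close> in either order gives \<open>dyad u\<close>; hence the
  difference is idempotent.\<close>

lemma orth_projector_diff_dyad:
  assumes Q: "orth_projector J Q" and u: "Q u = u" "norm u = 1"
  shows "orth_projector J (\<lambda>x. Q x - dyad u x)"
proof -
  note Q' = orth_projector_simps[OF Q]
  have "Q (dyad u x) = dyad u x" for x
    by (simp add: dyad_def Q'(6) u)
  moreover have "dyad u (Q x) = dyad u x" for x
    by (simp add: dyad_def flip: Q'(5)) (simp add: u)
  moreover have "dyad u (dyad u x) = dyad u x" for x
    by (simp add: dyad_def cinner_cscale_right cinner_self u)
  moreover have "dyad u (J x) = J (dyad u x)" for x
    by (simp add: dyad_eq J_inner_left)
  moreover have "cinner J (dyad u x) y = cinner J x (dyad u y)" for x y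
    by (simp add: dyad_def cinner_cscale_left cinner_cscale_right flip: cinner_commute)
  ultimately show ?thesis
    unfolding orth_projector_def clinear_def
    by (auto simp: Q' linear_dyad linear_diff[OF Q'(1)] linear_diff[OF linear_dyad] cinner_diff_right
        cinner_diff_left fun_eq_iff linear_compose_sub[OF Q'(1) linear_dyad])
qed

lemma subspace_range: "orth_projector J Q \<Longrightarrow> C.subspace (range Q)"
  by (auto simp: C.subspace_def range_projector orth_projector_simps(6) linear_add[OF orth_projector_simps(1)]
      linear_0[OF orth_projector_simps(1)])

text \<open>Adjoining \<open>u\<close> to a basis of the smaller range gives a basis of
  \<open>range Q\<close>. The exchange bound, applied in both directions, shows that it has as many
  elements as \<open>B\<close>.\<close>

lemma cdim_eq_diff_dyad:
  assumes Q: "orth_projector J Q" and u: "Q u = u" "norm u = 1"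
    and m: "cdim_eq J (range Q) (Suc m)"
  shows "cdim_eq J (range (\<lambda>x. Q x - dyad u x)) m"
proof -
  let ?R = "\<lambda>x. Q x - dyad u x"
  have R: "orth_projector J ?R" by (rule orth_projector_diff_dyad[OF Q u])
  obtain B where B: "finite B" "card B = Suc m" "C.independent B" "C.span B = range Q"
    using m by (auto simp: cdim_eq_def cindependent_iff cspan_eq_span)
  obtain B' where B': "B' \<subseteq> range ?R" "C.independent B'" "range ?R \<subseteq> C.span B'"
    by (rule C.maximal_independent_subset)
  have sp: "C.span B' = range ?R"
    using B' C.span_minimal[OF B'(1) subspace_range[OF R]] by blast
  have "?R u = 0" "u \<noteq> 0" using u by (auto simp: dyad_self)
  then have u': "u \<notin> C.span B'" unfolding sp range_projector[OF R] by auto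
  then have ind: "C.independent (insert u B')"
    using B'(2) C.independent_insertI by blast
  have "range ?R \<subseteq> range Q"
    by (auto simp: range_projector[OF Q] orth_projector_simps[OF Q] linear_diff[OF orth_projector_simps(1)[OF Q]] dyad_def u)
  then have sub: "insert u B' \<subseteq> C.span B"
    using B' u by (auto simp: B(4) range_projector[OF Q])
  have "B \<subseteq> C.span (insert u B')"
  proof
    fix x assume "x \<in> B"
    then have "Q x = x" using C.span_base[of x B] B(4) range_projector[OF Q] by auto
    then have "x = ?R x + cscale J (cinner J u x) u" by (simp add: dyad_def)
    moreover have "?R x \<in> C.span (insert u B')"
      using sp C.span_mono[of B' "insert u B'"] by blast
    moreover have "cscale J (cinner J u x) u \<in> C.span (insert u B')"
      by (intro C.span_scale C.span_base) simp
    ultimately show "x \<in> C.span (insert u B')" by (metis C.span_add)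
  qed
  moreover have fin: "finite (insert u B')" "card (insert u B') \<le> card B"
    using C.independent_span_bound[OF B(1) ind sub] by auto
  ultimately have "card (insert u B') = card B"
    using C.independent_span_bound[OF fin(1) B(3)] by simp
  moreover have "u \<notin> B'" using u' C.span_base by blast
  ultimately have "card B' = m" using fin B(2) by simp
  then show ?thesis
    using fin B'(2) sp by (auto simp: cdim_eq_def cindependent_iff cspan_eq_span intro!: exI[of _ B'])
qed

lemma cdim_eq_0: "cdim_eq J V 0 \<Longrightarrow> V = {0}"
  by (auto simp: cdim_eq_def cspan_eq_span)

lemma cdim_eq_Suc_unit:
  assumes Q: "orth_projector J Q" and m: "cdim_eq J (range Q) (Suc m)"
  obtains u where "Q u = u" "norm u = 1"
proof -
  obtain B where B: "finite B" "card B = Suc m" "C.independent B" "C.span B = range Q"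
    using m by (auto simp: cdim_eq_def cindependent_iff cspan_eq_span)
  then obtain b where b: "b \<in> B" by (metis card.empty ex_in_conv nat.distinct(1))
  then have "b \<noteq> 0" using B(3) C.dependent_zero by blast
  moreover have "Q b = b" using b C.span_base[of b B] B(4) range_projector[OF Q] by auto
  ultimately show ?thesis
    by (intro that[of "b /\<^sub>R norm b"]) (auto simp: linear_scale[OF orth_projector_simps(1)[OF Q]])
qed

end

section \<open>Equivariant families of projectors\<close>

definition int_vecs :: "(real^'d) set" where
  "int_vecs = {l. \<forall>i. l $ i \<in> \<int>}"

lemma int_vecs_0 [simp]: "0 \<in> int_vecs"
  and int_vecs_add: "a \<in> int_vecs \<Longrightarrow> b \<in> int_vecs \<Longrightarrow> a + b \<in> int_vecs"
  and int_vecs_diff: "a \<in> int_vecs \<Longrightarrow> b \<in> int_vecs \<Longrightarrow> a - b \<in> int_vecs"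
  and int_vecs_minus: "a \<in> int_vecs \<Longrightarrow> - a \<in> int_vecs"
  by (auto simp: int_vecs_def)

lemma finite_vec_components:
  assumes "finite A"
  shows "finite {l::'a^'d. \<forall>i. l $ i \<in> A}"
proof -
  have "{l::'a^'d. \<forall>i. l $ i \<in> A} \<subseteq> vec_lambda ` {f. \<forall>i. f i \<in> A}"
    by (auto intro!: image_eqI[of _ _ "vec_nth _"])
  moreover have "finite {f::'d \<Rightarrow> 'a. \<forall>i. f i \<in> A}"
    using finite_PiE[of "UNIV::'d set" "\<lambda>_. A"] assms by (simp add: PiE_UNIV_domain Pi_def)
  ultimately show ?thesis by (meson finite_imageI finite_subset)
qed

lemma finite_int_vecs: "finite {l \<in> (int_vecs :: (real^'d) set). norm l \<le> R}"
proof (rule finite_subset)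
  show "{l \<in> (int_vecs :: (real^'d) set). norm l \<le> R} \<subseteq> {l. \<forall>i. l $ i \<in> {x \<in> \<int>. \<bar>x\<bar> \<le> R}}"
    by (auto simp: int_vecs_def) (metis component_le_norm_cart order_trans)
  show "finite {l::real^'d. \<forall>i. l $ i \<in> {x \<in> \<int>. \<bar>x\<bar> \<le> R}}"
    by (rule finite_vec_components, rule finite_abs_int_segment)
qed

lemma closed_int_vecs: "closed (int_vecs :: (real^'d) set)"
proof -
  have "(int_vecs :: (real^'d) set) = (\<Inter>i. (\<lambda>x. x $ i) -` (\<int> :: real set))" by (auto simp: int_vecs_def)
  moreover have "closed (\<Inter>i. (\<lambda>x::real^'d. x $ i) -` (\<int> :: real set))"
    by (intro closed_INT ballI closed_vimage_vec_nth closed_Ints)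
  ultimately show ?thesis by argo
qed

lemma int_vecs_norm_less_1:
  assumes "l \<in> int_vecs" "norm l < 1" shows "l = 0"
proof -
  have "l $ i = 0" for i
  proof -
    have "\<bar>l $ i\<bar> < 1" using component_le_norm_cart[of l i] assms(2) by linarith
    moreover have "l $ i \<in> \<int>" using assms(1) by (simp add: int_vecs_def)
    ultimately show ?thesis using Ints_nonzero_abs_less1 by blast
  qed
  then show ?thesis by (simp add: vec_eq_iff)
qed

text \<open>These points of the unit cube are the ones fixed by \<open>k \<mapsto> -k\<close> modulo
  the lattice. Doubling maps them injectively to integer vectors of bounded norm.\<close>

lemma finite_fixed_points: "finite {k \<in> cbox 0 1 :: (real^'d) set. k + k \<in> int_vecs}"
proof -
  obtain R where R: "\<And>x :: real^'d. x \<in> cbox 0 1 \<Longrightarrow> norm x \<le> R"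
    using bounded_cbox[of "0::real^'d" 1] by (auto simp: bounded_iff)
  have "k \<in> (\<lambda>l. l /\<^sub>R 2) ` {l \<in> int_vecs. norm l \<le> 2 * R}" if "k \<in> cbox 0 1" "k + k \<in> int_vecs" for k :: "real^'d"
    using that R[of k] by (intro image_eqI[of _ _ "k + k"]) (auto simp flip: scaleR_2)
  then show ?thesis
    by (intro finite_subset[OF _ finite_imageI[OF finite_int_vecs[of "2 * R"], of "\<lambda>l. l /\<^sub>R 2"]]) blast
qed

lemma ex_int_vec_unit_cube:
  obtains l where "l \<in> int_vecs" "k - l \<in> cbox 0 1"
proof
  show "(\<chi> i. of_int \<lfloor>k $ i\<rfloor>) \<in> int_vecs" by (simp add: int_vecs_def)
  show "k - (\<chi> i. of_int \<lfloor>k $ i\<rfloor>) \<in> cbox 0 1"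
    by (auto simp: mem_box_cart) linarith
qed

section \<open>Lattice translations and time reversal\<close>

locale time_reversal = complex_hilbert J for J :: "'h::real_inner \<Rightarrow> 'h" +
  fixes \<tau> :: "real^'d \<Rightarrow> 'h \<Rightarrow> 'h" and \<Theta> :: "'h \<Rightarrow> 'h"
  assumes \<tau>_unitary: "l \<in> int_vecs \<Longrightarrow> unitary_op J (\<tau> l)"
    and \<tau>_0: "\<tau> 0 = id"
    and \<tau>_add: "l1 \<in> int_vecs \<Longrightarrow> l2 \<in> int_vecs \<Longrightarrow> \<tau> (l1 + l2) = \<tau> l1 \<circ> \<tau> l2"
    and \<Theta>_antiunitary: "antiunitary_op J \<Theta>"
    and \<Theta>_involution: "\<Theta> \<circ> \<Theta> = id"
    and \<Theta>_\<tau>_inv: "l \<in> int_vecs \<Longrightarrow> \<Theta> \<circ> \<tau> l = inv (\<tau> l) \<circ> \<Theta>"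
begin

lemma linear_\<tau>: "l \<in> int_vecs \<Longrightarrow> linear (\<tau> l)"
  and \<tau>_J: "l \<in> int_vecs \<Longrightarrow> \<tau> l (J x) = J (\<tau> l x)"
  and cinner_\<tau>: "l \<in> int_vecs \<Longrightarrow> cinner J (\<tau> l x) (\<tau> l y) = cinner J x y"
  using \<tau>_unitary by (auto simp: unitary_op_def clinear_def)

lemma inner_\<tau>: "l \<in> int_vecs \<Longrightarrow> \<tau> l x \<bullet> \<tau> l y = x \<bullet> y"
  using cinner_\<tau>[of l x y] by (simp add: cinner_def)

lemma norm_\<tau>: "l \<in> int_vecs \<Longrightarrow> norm (\<tau> l x) = norm x"
  by (simp add: norm_eq_sqrt_inner inner_\<tau>)

lemma \<tau>_zero: "l \<in> int_vecs \<Longrightarrow> \<tau> l 0 = 0"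
  using linear_0[OF linear_\<tau>] .

lemma \<tau>_cscale: "l \<in> int_vecs \<Longrightarrow> \<tau> l (cscale J z x) = cscale J z (\<tau> l x)"
  by (simp add: cscale_def linear_add[OF linear_\<tau>] linear_scale[OF linear_\<tau>] \<tau>_J)

lemma bounded_linear_\<tau>: "l \<in> int_vecs \<Longrightarrow> bounded_linear (\<tau> l)"
  by (rule bounded_linear_intro[where K=1])
    (auto simp: linear_add[OF linear_\<tau>] linear_scale[OF linear_\<tau>] norm_\<tau>)

lemma \<tau>_\<tau>: "l1 \<in> int_vecs \<Longrightarrow> l2 \<in> int_vecs \<Longrightarrow> \<tau> l1 (\<tau> l2 x) = \<tau> (l1 + l2) x"
  by (simp add: \<tau>_add)

lemma \<tau>_minus: "l \<in> int_vecs \<Longrightarrow> \<tau> (- l) (\<tau> l x) = x" "l \<in> int_vecs \<Longrightarrow> \<tau> l (\<tau> (- l) x) = x"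
  by (simp_all add: \<tau>_\<tau> int_vecs_minus \<tau>_0)

lemma inv_\<tau>: "l \<in> int_vecs \<Longrightarrow> inv (\<tau> l) = \<tau> (- l)"
  by (rule inv_unique_comp) (auto simp: fun_eq_iff \<tau>_minus)

lemma \<Theta>_\<tau>: "l \<in> int_vecs \<Longrightarrow> \<Theta> (\<tau> l x) = \<tau> (- l) (\<Theta> x)"
  using \<Theta>_\<tau>_inv[of l] by (simp add: inv_\<tau> fun_eq_iff)

lemma linear_\<Theta>: "linear \<Theta>" and \<Theta>_J: "\<Theta> (J x) = - J (\<Theta> x)"
  and cinner_\<Theta>: "cinner J (\<Theta> x) (\<Theta> y) = cinner J y x"
  using \<Theta>_antiunitary by (auto simp: antiunitary_op_def cantilinear_def)

lemma \<Theta>_\<Theta> [simp]: "\<Theta> (\<Theta> x) = x"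
  using \<Theta>_involution by (simp add: fun_eq_iff)

lemma inner_\<Theta> [simp]: "\<Theta> x \<bullet> \<Theta> y = x \<bullet> y"
  using cinner_\<Theta>[of x y] by (simp add: cinner_def inner_commute)

lemma norm_\<Theta> [simp]: "norm (\<Theta> x) = norm x"
  by (simp add: norm_eq_sqrt_inner)

lemma \<Theta>_cscale: "\<Theta> (cscale J z x) = cscale J (cnj z) (\<Theta> x)"
  by (simp add: cscale_def linear_add[OF linear_\<Theta>] linear_scale[OF linear_\<Theta>] \<Theta>_J)

lemma bounded_linear_\<Theta>: "bounded_linear \<Theta>"
  by (rule bounded_linear_intro[where K=1])
    (auto simp: linear_add[OF linear_\<Theta>] linear_scale[OF linear_\<Theta>])

text \<open>
  For \<open>w\<close> of bounded support this is \<open>\<Sum>\<^sub>l \<tau>\<^sub>l w(k - l)\<close>, the equivariant extension of \<open>w\<close>; the index set is cut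
  down to the nonzero terms because a sum over an infinite set is 0.
\<close>

definition spread :: "(real^'d \<Rightarrow> 'h) \<Rightarrow> real^'d \<Rightarrow> 'h" where
  "spread w k = (\<Sum>l\<in>{l \<in> int_vecs. w (k - l) \<noteq> 0}. \<tau> l (w (k - l)))"

lemma spread_eq_sum:
  assumes "finite F" "F \<subseteq> int_vecs" "\<And>l. l \<in> int_vecs \<Longrightarrow> w (k - l) \<noteq> 0 \<Longrightarrow> l \<in> F"
  shows "spread w k = (\<Sum>l\<in>F. \<tau> l (w (k - l)))"
  unfolding spread_def
  by (rule sum.mono_neutral_left) (use assms \<tau>_zero in auto)

lemma spread_eq_single:
  assumes "l \<in> int_vecs" "\<And>l'. l' \<in> int_vecs \<Longrightarrow> l' \<noteq> l \<Longrightarrow> w (k - l') = 0"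
  shows "spread w k = \<tau> l (w (k - l))"
proof -
  have "spread w k = (\<Sum>l\<in>{l}. \<tau> l (w (k - l)))"
    by (rule spread_eq_sum) (use assms in blast)+
  then show ?thesis by simp
qed

lemma finite_spread:
  assumes "\<And>x. w x \<noteq> 0 \<Longrightarrow> norm x \<le> R"
  shows "finite {l \<in> int_vecs. w (k - l) \<noteq> 0}"
proof (rule finite_subset[OF _ finite_int_vecs[of "norm k + R"]], safe)
  fix l assume "w (k - l) \<noteq> 0"
  then have "norm (k - l) \<le> R" by (rule assms)
  then show "norm l \<le> norm k + R" using norm_triangle_ineq2[of l k] by (simp add: norm_minus_commute)
qed

text \<open>On the unit ball around any point, one finite set of lattice vectors catches all nonzero
  terms, so the extension is locally a finite sum of smooth maps.\<close>

lemma smooth_spread: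
  assumes w: "smooth_map w" and R: "\<And>x. w x \<noteq> 0 \<Longrightarrow> norm x \<le> R"
  shows "smooth_map (spread w)"
proof (rule smooth_map_locally)
  fix x :: "real^'d"
  let ?F = "{l \<in> (int_vecs :: (real^'d) set). norm l \<le> norm x + 1 + R}"
  let ?g = "\<lambda>k. \<Sum>l\<in>?F. \<tau> l (w (k - l))"
  have "spread w k = ?g k" if "k \<in> ball x 1" for k
  proof (rule spread_eq_sum[OF finite_int_vecs])
    fix l :: "real^'d" assume l: "l \<in> int_vecs" and "w (k - l) \<noteq> 0"
    then have "norm (k - l) \<le> R" using R by blast
    moreover have "norm (k - x) < 1" using that by (simp add: dist_norm norm_minus_commute)
    ultimately have "norm l \<le> norm x + 1 + R"
      using norm_triangle_ineq2[of l k] norm_triangle_ineq2[of k x] norm_minus_commute[of l k] by linarith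
    then show "l \<in> ?F" using l by simp
  qed auto
  moreover have "smooth_map ?g"
    by (intro smooth_map_sum smooth_map_bounded_linear[OF bounded_linear_\<tau>] smooth_map_shift w) auto
  ultimately show "\<exists>U g. open U \<and> x \<in> U \<and> (\<forall>y\<in>U. spread w y = g y) \<and> smooth_map g"
    by (intro exI[of _ "ball x 1"] exI[of _ ?g]) auto
qed

lemma spread_translate:
  assumes "m \<in> int_vecs"
  shows "spread w (k + m) = \<tau> m (spread w k)"
proof -
  have "\<tau> m (spread w k) = (\<Sum>l\<in>{l \<in> int_vecs. w (k - l) \<noteq> 0}. \<tau> m (\<tau> l (w (k - l))))"
    unfolding spread_def by (rule linear_sum[OF linear_\<tau>[OF assms]])
  also have "\<dots> = spread w (k + m)"
    unfolding spread_def
    by (rule sum.reindex_bij_witness[of _ "\<lambda>l. l - m" "\<lambda>l. l + m"])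
      (auto simp: int_vecs_add int_vecs_diff assms \<tau>_\<tau> algebra_simps)
  finally show ?thesis ..
qed

text \<open>Unitarity moves every term back to the point \<open>k - l\<close>, so positivity of the
  sum can be read off pointwise from \<open>w\<close>.\<close>

lemma inner_spread:
  assumes \<phi>: "\<And>k l. l \<in> int_vecs \<Longrightarrow> \<phi> (k + l) = \<tau> l (\<phi> k)"
  shows "\<phi> k \<bullet> spread w k = (\<Sum>l\<in>{l \<in> int_vecs. w (k - l) \<noteq> 0}. \<phi> (k - l) \<bullet> w (k - l))"
  unfolding spread_def inner_sum_right
proof (rule sum.cong[OF refl])
  fix l assume "l \<in> {l \<in> int_vecs. w (k - l) \<noteq> 0}"
  then have l: "l \<in> int_vecs" by simp
  show "\<phi> k \<bullet> \<tau> l (w (k - l)) = \<phi> (k - l) \<bullet> w (k - l)"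
    using \<phi>[OF l, of "k - l"] inner_\<tau>[OF l] by simp
qed

text \<open>An open ball of radius at most 1/2 has pairwise disjoint integer translates, so at any
  point at most one term of the spread is nonzero.\<close>

lemma
  assumes r: "r \<le> 1/2" and supp: "\<And>x. w x \<noteq> 0 \<Longrightarrow> dist k0 x < r"
  shows spread_on_ball: "dist k0 k < r \<Longrightarrow> spread w k = w k"
    and norm_spread_le: "(\<And>x. norm (w x) \<le> C) \<Longrightarrow> norm (spread w k) \<le> C"
proof -
  have uniq: "l = l'" if "l \<in> int_vecs" "l' \<in> int_vecs" "dist k0 (k - l) < r" "dist k0 (k - l') < r" for l l' k
  proof -
    have "dist (k - l) (k - l') < 1"
      using dist_triangle2[of "k - l" "k - l'" k0] dist_triangle[of "k - l" "k - l'" k0] that r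
      by (simp add: dist_commute)
    then have "norm (l' - l) < 1" by (simp add: dist_norm)
    then show ?thesis using int_vecs_norm_less_1[OF int_vecs_diff[OF that(2,1)]] by simp
  qed
  show "spread w k = w k" if k: "dist k0 k < r"
  proof -
    have "spread w k = \<tau> 0 (w (k - 0))"
    proof (rule spread_eq_single)
      fix l :: "real^'d" assume "l \<in> int_vecs" "l \<noteq> 0"
      then show "w (k - l) = 0" using uniq[of l 0 k] supp[of "k - l"] k by auto
    qed simp
    then show ?thesis by (simp add: \<tau>_0)
  qed
  show "norm (spread w k) \<le> C" if C: "\<And>x. norm (w x) \<le> C"
  proof (cases "\<exists>l\<in>int_vecs. w (k - l) \<noteq> 0")
    case True
    then obtain l where l: "l \<in> int_vecs" "w (k - l) \<noteq> 0" by blast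
    have "spread w k = \<tau> l (w (k - l))"
    proof (rule spread_eq_single)
      fix l' :: "real^'d" assume "l' \<in> int_vecs" "l' \<noteq> l"
      then show "w (k - l') = 0" using uniq[of l' l k] supp[of "k - l'"] supp[of "k - l"] l by auto
    qed (rule l)
    then show ?thesis using C l by (simp add: norm_\<tau>)
  next
    case False
    then have "{l \<in> int_vecs. w (k - l) \<noteq> 0} = {}" by blast
    moreover have "C \<ge> 0" using C[of 0] norm_ge_zero order_trans by blast
    ultimately show ?thesis by (simp only: spread_def sum.empty norm_zero)
  qed
qed

text \<open>Adding the reversed copy gives a reversal-invariant map because \<open>\<Theta>\<close>
  is an involution. There is no factor 1/2, whence the 2 in
  \<open>norm_symmetrize_local\<close>.\<close>

definition symmetrize :: "(real^'d \<Rightarrow> 'h) \<Rightarrow> real^'d \<Rightarrow> 'h" where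
  "symmetrize w k = spread w k + \<Theta> (spread w (- k))"

lemma smooth_symmetrize:
  assumes "smooth_map w" "\<And>x. w x \<noteq> 0 \<Longrightarrow> norm x \<le> R"
  shows "smooth_map (symmetrize w)"
  unfolding symmetrize_def[abs_def]
  by (intro smooth_map_add smooth_map_bounded_linear[OF bounded_linear_\<Theta>] smooth_map_reflect smooth_spread[OF assms])

end

text \<open>Smoothness is stated for each fixed vector \<open>x\<close>, and covariance as
  intertwining without inverses. In this form both properties pass directly to the family left after
  splitting off a line.\<close>

locale bloch_family = time_reversal J \<tau> \<Theta>
  for J :: "'h::real_inner \<Rightarrow> 'h" and \<tau> :: "real^'d \<Rightarrow> 'h \<Rightarrow> 'h" and \<Theta> +
  fixes P :: "real^'d \<Rightarrow> 'h \<Rightarrow> 'h" and m :: nat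
  assumes projector: "orth_projector J (P k)"
    and rank: "cdim_eq J (range (P k)) m"
    and smooth: "smooth_map (\<lambda>k. P k x)"
    and translate: "l \<in> int_vecs \<Longrightarrow> P (k + l) (\<tau> l x) = \<tau> l (P k x)"
    and reflect: "P (- k) (\<Theta> x) = \<Theta> (P k x)"
begin

lemmas P_simps = orth_projector_simps[OF projector]
lemmas linear_P = P_simps(1) and P_J = P_simps(2) and P_P = P_simps(3) and P_inner = P_simps(4)
  and P_cinner = P_simps(5) and P_cscale = P_simps(6) and norm_P = P_simps(7)

text \<open>Regularity is kept separate from the symmetries, because in rank one the section is at
  first only continuous.\<close>

definition bloch_section :: "(real^'d \<Rightarrow> 'h) \<Rightarrow> bool" where
  "bloch_section s \<longleftrightarrow> (\<forall>k. P k (s k) = s k) \<and> (\<forall>k. \<forall>l\<in>int_vecs. s (k + l) = \<tau> l (s k)) \<and>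
     (\<forall>k. s (- k) = \<Theta> (s k))"

lemma bloch_sectionD:
  assumes "bloch_section s"
  shows "P k (s k) = s k" "l \<in> int_vecs \<Longrightarrow> s (k + l) = \<tau> l (s k)" "s (- k) = \<Theta> (s k)"
  using assms by (auto simp: bloch_section_def)

lemma P_spread:
  assumes w: "\<And>k. P k (w k) = w k"
  shows "P k (spread w k) = spread w k"
  unfolding spread_def linear_sum[OF linear_P]
proof (rule sum.cong[OF refl])
  fix l assume "l \<in> {l \<in> int_vecs. w (k - l) \<noteq> 0}"
  then show "P k (\<tau> l (w (k - l))) = \<tau> l (w (k - l))"
    using translate[of l "k - l"] w by simp
qed

lemma bloch_section_symmetrize:
  assumes w: "\<And>k. P k (w k) = w k"
  shows "bloch_section (symmetrize w)"
  unfolding bloch_section_def symmetrize_def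
proof (intro conjI allI ballI)
  fix k
  show "P k (spread w k + \<Theta> (spread w (- k))) = spread w k + \<Theta> (spread w (- k))"
    using reflect[of "- k" "spread w (- k)"] P_spread[OF w] by (simp add: linear_add[OF linear_P])
  show "spread w (- k) + \<Theta> (spread w (- (- k))) = \<Theta> (spread w k + \<Theta> (spread w (- k)))"
    by (simp add: linear_add[OF linear_\<Theta>])
  fix l :: "real^'d" assume l: "l \<in> int_vecs"
  \<comment> \<open>In the reversed term the translation appears as \<open>\<tau> (- l)\<close>;
    passing it through \<open>\<Theta>\<close> turns it into \<open>\<tau> l\<close>.\<close>
  then show "spread w (k + l) + \<Theta> (spread w (- (k + l))) = \<tau> l (spread w k + \<Theta> (spread w (- k)))"
    using spread_translate[OF int_vecs_minus[OF l], of w "- k"]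
    by (simp add: spread_translate \<Theta>_\<tau> int_vecs_minus linear_add[OF linear_\<tau>])
qed

lemma bloch_section_add: "bloch_section s \<Longrightarrow> bloch_section t \<Longrightarrow> bloch_section (\<lambda>k. s k + t k)"
  by (simp add: bloch_section_def linear_add[OF linear_P] linear_add[OF linear_\<tau>] linear_add[OF linear_\<Theta>])

lemma bloch_section_periodic_scaleR:
  assumes "bloch_section s" "\<And>k l. l \<in> int_vecs \<Longrightarrow> c (k + l) = c k" "\<And>k. c (- k) = c k"
  shows "bloch_section (\<lambda>k. c k *\<^sub>R s k)"
  using assms
  by (simp add: bloch_section_def linear_scale[OF linear_P] linear_scale[OF linear_\<tau>] linear_scale[OF linear_\<Theta>])

lemma normalize_section:
  assumes s: "smooth_map s" "bloch_section s" "\<And>k. s k \<noteq> 0"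
  obtains \<phi> where "smooth_map \<phi>" "bloch_section \<phi>" "\<And>k. norm (\<phi> k) = 1"
proof
  \<comment> \<open>The inverse norm is written as a real power of the squared norm, which is smooth
    away from zeros and invariant because the symmetries are isometries.\<close>
  let ?c = "\<lambda>k. (s k \<bullet> s k) powr (- 1/2)"
  show "smooth_map (\<lambda>k. ?c k *\<^sub>R s k)"
    by (intro smooth_map_scaleR smooth_map_powr smooth_map_inner s(1)) (use s(3) in auto)
  show "bloch_section (\<lambda>k. ?c k *\<^sub>R s k)"
    by (rule bloch_section_periodic_scaleR[OF s(2)])
      (use bloch_sectionD[OF s(2)] in \<open>simp_all add: inner_\<tau>\<close>)
  show "norm (?c k *\<^sub>R s k) = 1" for k
    using s(3)[of k] by (simp add: powr_minus_divide powr_half_sqrt flip: norm_eq_sqrt_inner)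
qed

lemma bloch_section_nonzero_UNIV:
  assumes "bloch_section s" "\<forall>k\<in>cbox 0 1. s k \<noteq> 0"
  shows "s k \<noteq> 0"
proof -
  obtain l where l: "l \<in> int_vecs" "k - l \<in> cbox 0 1" by (rule ex_int_vec_unit_cube)
  then have "s k = \<tau> l (s (k - l))" using bloch_sectionD(2)[OF assms(1) l(1), of "k - l"] by simp
  then have "norm (s k) = norm (s (k - l))" using l by (simp add: norm_\<tau>)
  then show ?thesis using assms(2) l(2) by auto
qed

text \<open>Near each \<open>q\<close> the smooth local section \<open>P x (\<phi> q)\<close> has
  positive inner product with \<open>\<phi>\<close>. Finitely many of these cover the unit cube;
  bump weights and \<open>symmetrize\<close> combine them.\<close>

lemma smooth_section_of_continuous:
  assumes \<phi>: "continuous_on UNIV \<phi>" "bloch_section \<phi>" "\<And>k. norm (\<phi> k) = 1"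
  obtains s where "smooth_map s" "bloch_section s" "\<And>k. s k \<noteq> 0"
proof -
  have "\<exists>r>0. \<forall>x. dist q x < r \<longrightarrow> \<phi> x \<bullet> \<phi> q > 0" for q
  proof -
    have "open {x. 0 < \<phi> x \<bullet> \<phi> q}"
      using \<phi>(1) by (intro open_Collect_less continuous_intros)
    moreover have "\<phi> q \<bullet> \<phi> q > 0" using \<phi>(3)[of q] by (metis norm_zero inner_gt_zero_iff zero_neq_one)
    ultimately show ?thesis by (force simp: open_contains_ball subset_iff)
  qed
  then obtain r where r: "\<And>q. r q > 0" "\<And>q x. dist q x < r q \<Longrightarrow> \<phi> x \<bullet> \<phi> q > 0" by metis
  let ?K = "cbox 0 1 :: (real^'d) set"
  obtain F where F: "F \<subseteq> ?K" "finite F" "?K \<subseteq> (\<Union>q\<in>F. ball q (r q))"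
  proof (rule compactE_image)
    show "?K \<subseteq> (\<Union>q\<in>?K. ball q (r q))" using r(1) by force
  qed auto
  txt \<open>All terms have nonnegative inner product with \<open>\<phi> x\<close>, so the average cannot vanish.\<close>
  define w where "w x = (\<Sum>q\<in>F. bump q (r q) x *\<^sub>R P x (\<phi> q))" for x
  have w_smooth: "smooth_map w"
    unfolding w_def[abs_def] by (intro smooth_map_sum smooth_map_scaleR smooth_map_bump smooth)
  have w_range: "P x (w x) = w x" for x
    by (simp add: w_def linear_sum[OF linear_P] linear_scale[OF linear_P] P_P)
  have w_supp: "norm x \<le> (\<Sum>q\<in>F. norm q + r q)" if wx: "w x \<noteq> 0" for x
  proof -
    obtain q where q: "q \<in> F" "bump q (r q) x \<noteq> 0"
      using wx sum.neutral[of F "\<lambda>q. bump q (r q) x *\<^sub>R P x (\<phi> q)"] unfolding w_def by fastforce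
    then have "dist q x < r q" using bump_eq_0_iff[OF r(1)[of q], of q x] by auto
    then have "norm x \<le> norm q + r q"
      using norm_triangle_ineq2[of x q] by (simp add: dist_norm norm_minus_commute)
    also have "\<dots> \<le> (\<Sum>q\<in>F. norm q + r q)"
      by (rule member_le_sum) (use q F r(1) in \<open>auto simp: less_imp_le add_nonneg_nonneg\<close>)
    finally show ?thesis .
  qed
  \<comment> \<open>Self-adjointness moves \<open>P x\<close> onto \<open>\<phi> x\<close>, which it
    fixes, so the projector drops out.\<close>
  have term_eq: "\<phi> x \<bullet> w x = (\<Sum>q\<in>F. bump q (r q) x * (\<phi> x \<bullet> \<phi> q))" for x
    using bloch_sectionD(1)[OF \<phi>(2)] by (simp add: w_def inner_sum_right flip: P_inner)
  have term_ge: "bump q (r q) x * (\<phi> x \<bullet> \<phi> q) \<ge> 0" for q x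
    using bump_pos_iff[OF r(1)[of q], of q x] bump_nonneg[of q "r q" x] r(2)[of q x]
    by (cases "bump q (r q) x = 0") (auto simp: less_imp_le)
  have w_ge: "\<phi> x \<bullet> w x \<ge> 0" for x
    unfolding term_eq by (intro sum_nonneg term_ge)
  have w_pos: "\<phi> x \<bullet> w x > 0" if x: "x \<in> ?K" for x
  proof -
    obtain q where q: "q \<in> F" "dist q x < r q" using x F(3) by auto
    then have "bump q (r q) x * (\<phi> x \<bullet> \<phi> q) > 0"
      using r bump_pos_iff[of "r q" q x] by simp
    then show ?thesis unfolding term_eq
      using q F(2) term_ge by (intro sum_pos2[of _ q]) auto
  qed
  have pos: "\<phi> k \<bullet> spread w k > 0" for k
  proof -
    obtain l where l: "l \<in> int_vecs" "k - l \<in> ?K" by (rule ex_int_vec_unit_cube)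
    have "w (k - l) \<noteq> 0" using w_pos[OF l(2)] by auto
    moreover have "\<phi> k \<bullet> spread w k = (\<Sum>l\<in>{l \<in> int_vecs. w (k - l) \<noteq> 0}. \<phi> (k - l) \<bullet> w (k - l))"
      by (rule inner_spread) (rule bloch_sectionD(2)[OF \<phi>(2)])
    moreover have "finite {l \<in> int_vecs. w (k - l) \<noteq> 0}"
      by (rule finite_spread) (rule w_supp)
    ultimately show ?thesis
      using l w_ge w_pos by (simp only:, intro sum_pos2[of _ l]) auto
  qed
  show ?thesis
  proof
    show "smooth_map (symmetrize w)" by (rule smooth_symmetrize[OF w_smooth w_supp])
    show "bloch_section (symmetrize w)" by (rule bloch_section_symmetrize[OF w_range])
    fix k
    \<comment> \<open>Reversal preserves the real inner product, so its contribution is the same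
      positive quantity taken at \<open>- k\<close>.\<close>
    have "\<phi> k \<bullet> symmetrize w k = \<phi> k \<bullet> spread w k + \<phi> (- k) \<bullet> spread w (- k)"
      using inner_\<Theta>[of "\<phi> (- k)" "spread w (- k)"] bloch_sectionD(3)[OF \<phi>(2), of "k"]
      by (simp add: symmetrize_def inner_add_right)
    then show "symmetrize w k \<noteq> 0" using pos[of k] pos[of "- k"] by auto
  qed
qed

end

section \<open>Rank at least two: perturbing away zeros\<close>

context bloch_family begin

definition local_section :: "real^'d \<Rightarrow> real \<Rightarrow> 'h \<Rightarrow> real^'d \<Rightarrow> 'h" where
  "local_section k0 r u k = bump k0 r k *\<^sub>R P k u"

lemma local_section_supp: "r > 0 \<Longrightarrow> local_section k0 r u x \<noteq> 0 \<Longrightarrow> dist k0 x < r"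
  using bump_eq_0_iff[of r k0 x] by (auto simp: local_section_def)

lemma smooth_symmetrize_local: "r > 0 \<Longrightarrow> smooth_map (symmetrize (local_section k0 r u))"
proof (rule smooth_symmetrize[where R = "norm k0 + r"])
  show "smooth_map (local_section k0 r u)"
    unfolding local_section_def[abs_def] by (intro smooth_map_scaleR smooth_map_bump smooth)
  fix x assume "r > 0" "local_section k0 r u x \<noteq> 0"
  then have "dist k0 x < r" by (rule local_section_supp)
  then show "norm x \<le> norm k0 + r"
    using norm_triangle_ineq2[of x k0] by (simp add: dist_norm norm_minus_commute)
qed

lemma bloch_section_symmetrize_local: "bloch_section (symmetrize (local_section k0 r u))"
  by (rule bloch_section_symmetrize) (simp add: local_section_def linear_scale[OF linear_P] P_P)

lemma norm_local_section: "norm (local_section k0 r u x) \<le> norm u"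
proof -
  have "bump k0 r x * norm (P x u) \<le> 1 * norm u"
    by (intro mult_mono bump_le_1 norm_P) auto
  then show ?thesis by (simp add: local_section_def bump_nonneg)
qed

lemma norm_symmetrize_local:
  assumes "0 < r" "r \<le> 1/2"
  shows "norm (symmetrize (local_section k0 r u) k) \<le> 2 * norm u"
proof -
  have "norm (spread (local_section k0 r u) k) \<le> norm u" for k
    by (rule norm_spread_le[OF assms(2) local_section_supp norm_local_section]) (use assms in auto)
  from this[of k] this[of "- k"] show ?thesis
    unfolding symmetrize_def
    using norm_triangle_ineq[of "spread (local_section k0 r u) k" "\<Theta> (spread (local_section k0 r u) (- k))"]
    by simp
qed

text \<open>The invariant of the removal of zeros. The section is only asserted to exist because
  every extension of \<open>K\<close> may replace it.\<close>

definition nonvanishing :: "(real^'d) set \<Rightarrow> bool" where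
  "nonvanishing K \<longleftrightarrow> (\<exists>s. smooth_map s \<and> bloch_section s \<and> (\<forall>k\<in>K. s k \<noteq> 0))"

text \<open>Compactness gives a margin: a perturbation of norm below \<delta> creates no zero on
  \<open>K\<close>.\<close>

lemma norm_bounded_below:
  assumes "compact K" "smooth_map s" "\<forall>k\<in>K. s k \<noteq> 0"
  obtains \<delta> where "\<delta> > 0" "\<forall>k\<in>K. \<delta> \<le> norm (s k)"
proof (cases "K = {}")
  case False
  then obtain x where "x \<in> K" "\<forall>y\<in>K. norm (s x) \<le> norm (s y)"
    using continuous_attains_inf[OF assms(1) False continuous_on_norm[OF smooth_map_continuous[OF assms(2)]]] by blast
  then show ?thesis using that[of "norm (s x)"] assms(3) by auto
qed (use that[of 1] in simp)

text \<open>Here \<open>\<tau> l0\<close> after \<open>\<Theta>\<close> is an antiunitary involution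
  of the fibre at \<open>k0\<close>. Symmetrizing a unit vector \<open>v\<close> gives a fixed
  vector; if the result is 0, then \<open>v\<close> is sent to \<open>- v\<close>, and antilinearity
  makes \<open>J v\<close> fixed instead.\<close>

lemma ex_real_vector:
  assumes l0: "l0 \<in> int_vecs" "l0 = k0 + k0" and m: "m = Suc n"
  obtains e where "P k0 e = e" "\<tau> l0 (\<Theta> e) = e" "e \<noteq> 0"
proof -
  let ?A = "\<lambda>x. \<tau> l0 (\<Theta> x)"
  have A_P: "?A (P k0 x) = P k0 (?A x)" for x
    using translate[OF l0(1), of "- k0" "\<Theta> x"] reflect[of k0 x] l0(2) by simp
  have A_A: "?A (?A x) = x" for x
    using \<Theta>_\<tau>[OF l0(1)] \<tau>_minus[OF l0(1)] by simp
  obtain v where v: "P k0 v = v" "norm v = 1"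
    using cdim_eq_Suc_unit[OF projector] rank m by metis
  show ?thesis
  proof (cases "v + ?A v = 0")
    case False
    then show ?thesis
      using A_P[of v] v A_A[of v]
      by (intro that[of "v + ?A v"])
        (simp_all add: linear_add[OF linear_P] linear_add[OF linear_\<Theta>] linear_add[OF linear_\<tau>[OF l0(1)]])
  next
    case True
    then have "?A v = - v" by (simp add: eq_neg_iff_add_eq_0 add.commute)
    then have "?A (J v) = J v"
      by (simp add: \<Theta>_J linear_neg[OF linear_\<tau>[OF l0(1)]] \<tau>_J[OF l0(1)])
    moreover have "J v \<noteq> 0" using v norm_J[of v] by force
    ultimately show ?thesis using v by (intro that[of "J v"]) (simp_all add: P_J)
  qed
qed

text \<open>At \<open>k0\<close> a symmetric section can only take values fixed by
  \<open>\<tau> (k0 + k0)\<close> after \<open>\<Theta>\<close>. The perturbation is directed along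
  such a vector, so that the two halves of \<open>symmetrize\<close> coincide at \<open>k0\<close>
  and cannot cancel.\<close>

lemma nonvanishing_insert_fixed_point:
  assumes k0: "k0 + k0 \<in> int_vecs" and m: "m = Suc n"
    and K: "compact K" "nonvanishing K"
  shows "nonvanishing (insert k0 K)"
proof -
  define l0 where "l0 = k0 + k0"
  have l0: "l0 \<in> int_vecs" using k0 by (simp add: l0_def)
  have k0_l0: "k0 - l0 = - k0" by (simp add: l0_def)
  let ?A = "\<lambda>x. \<tau> l0 (\<Theta> x)"
  obtain e where e: "P k0 e = e" "?A e = e" "e \<noteq> 0"
    using ex_real_vector[OF l0 l0_def m] .
  let ?r = "1/2 :: real"
  have loc: "symmetrize (local_section k0 ?r (c *\<^sub>R e)) k0 = (2 * c * bump k0 ?r k0) *\<^sub>R e" for c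
  proof -
    let ?w = "local_section k0 ?r (c *\<^sub>R e)"
    have 1: "spread ?w k0 = (c * bump k0 ?r k0) *\<^sub>R e"
      by (subst spread_on_ball[OF _ local_section_supp])
        (auto simp: local_section_def linear_scale[OF linear_P] e)
    have "spread ?w (- k0) = \<tau> (- l0) (spread ?w k0)"
      using spread_translate[OF int_vecs_minus[OF l0], of ?w k0] by (simp add: k0_l0)
    then have "\<Theta> (spread ?w (- k0)) = ?A (spread ?w k0)"
      using \<Theta>_\<tau>[OF int_vecs_minus[OF l0]] by simp
    also have "\<dots> = (c * bump k0 ?r k0) *\<^sub>R e"
      unfolding 1 by (simp add: linear_scale[OF linear_\<Theta>] linear_scale[OF linear_\<tau>[OF l0]] e)
    finally show ?thesis unfolding symmetrize_def 1 by (simp add: algebra_simps flip: scaleR_add_left)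
  qed
  obtain s where s: "smooth_map s" "bloch_section s" "\<forall>k\<in>K. s k \<noteq> 0"
    using K(2) by (auto simp: nonvanishing_def)
  show ?thesis
  proof (cases "s k0 = 0")
    case False
    then show ?thesis using s by (auto simp: nonvanishing_def)
  next
    case True
    obtain \<delta> where \<delta>: "\<delta> > 0" "\<forall>k\<in>K. \<delta> \<le> norm (s k)" using norm_bounded_below[OF K(1) s(1,3)] .
    \<comment> \<open>With this scale the bound \<open>2 * norm (c *\<^sub>R e)\<close> on the
      perturbation is \<delta>/2, below the margin on \<open>K\<close>.\<close>
    define c where "c = \<delta> / (4 * norm e)"
    have c: "c > 0" "2 * norm (c *\<^sub>R e) < \<delta>" using \<delta> e by (auto simp: c_def)
    let ?t = "symmetrize (local_section k0 ?r (c *\<^sub>R e))"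
    have "s k + ?t k \<noteq> 0" if "k \<in> K" for k
    proof
      assume "s k + ?t k = 0"
      then have "norm (s k) = norm (?t k)" by (metis add_eq_0_iff norm_minus_cancel)
      also have "\<dots> < \<delta>" using norm_symmetrize_local[of ?r k0 "c *\<^sub>R e" k] c by simp
      finally show False using \<delta> that by force
    qed
    moreover have "bump k0 ?r k0 > 0" by (simp add: bump_pos_iff)
    then have "s k0 + ?t k0 \<noteq> 0" unfolding loc True using c e by simp
    ultimately show ?thesis
      unfolding nonvanishing_def
      by (intro exI[of _ "\<lambda>k. s k + ?t k"])
        (auto intro!: smooth_map_add bloch_section_add s smooth_symmetrize_local bloch_section_symmetrize_local)
  qed
qed

lemma ex_two_orthonormal:
  assumes m: "m = Suc (Suc n)"
  obtains e1 e2 where "P k e1 = e1" "P k e2 = e2" "cinner J e1 e1 = 1" "cinner J e2 e2 = 1"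
    "cinner J e1 e2 = 0" "cinner J e2 e1 = 0" "norm e1 = 1" "norm e2 = 1"
proof -
  obtain e1 where e1: "P k e1 = e1" "norm e1 = 1"
    using cdim_eq_Suc_unit[OF projector] rank m by metis
  let ?Q = "\<lambda>x. P k x - dyad e1 x"
  have Q: "orth_projector J ?Q" by (rule orth_projector_diff_dyad[OF projector e1])
  have "cdim_eq J (range ?Q) (Suc n)"
    using cdim_eq_diff_dyad[OF projector e1] rank[of k] m by simp
  then obtain e2 where e2: "?Q e2 = e2" "norm e2 = 1" using cdim_eq_Suc_unit[OF Q] by metis
  have "?Q e1 = 0" using e1 by (simp add: dyad_self)
  then have 0: "cinner J e1 e2 = 0"
    using orth_projector_simps(5)[OF Q, of e1 e2] e2 by simp
  then have "P k e2 = e2" using e2 by (simp add: dyad_def)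
  then show ?thesis
    using that e1 e2 0 cinner_self[of e1] cinner_self[of e2] cinner_commute[of e1 e2]
    by (metis complex_cnj_zero cinner_commute of_real_1 one_power2)
qed

text \<open>Near \<open>k0\<close> no point is equivalent to the reflection of a nearby one, so the
  values there are unconstrained. The radius depends on \<open>k0\<close> alone and not on
  \<open>K\<close>; hence a finite cover can be fixed before any section is perturbed.\<close>

lemma nonvanishing_extend_free_point:
  assumes k0: "k0 + k0 \<notin> int_vecs" and m: "m = Suc (Suc n)" and dim: "CARD('d) \<le> 3"
  obtains \<rho> where "\<rho> > 0" "\<And>K. compact K \<Longrightarrow> nonvanishing K \<Longrightarrow> nonvanishing (K \<union> cball k0 \<rho>)"
proof -
  obtain e1 e2 where e: "P k0 e1 = e1" "P k0 e2 = e2" "cinner J e1 e1 = 1" "cinner J e2 e2 = 1"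
    "cinner J e1 e2 = 0" "cinner J e2 e1 = 0" "norm e1 = 1" "norm e2 = 1"
    using ex_two_orthonormal[OF m] .
  obtain d where d: "d > 0" "\<forall>l\<in>int_vecs. d \<le> dist (k0 + k0) l"
    using separate_point_closed[OF closed_int_vecs k0] by blast
  let ?M = "\<lambda>x y k. cinner J x (P k y)"
  have smM: "smooth_map (?M x y)" for x y
    by (intro smooth_map_bounded_linear[OF bounded_linear_cinner] smooth)
  \<comment> \<open>The determinant of the compression of \<open>P k\<close> to the span of
    \<open>e1\<close> and \<open>e2\<close>. It equals 1 at \<open>k0\<close>, so the linear system
    for the two parameters stays uniquely solvable nearby.\<close>
  define D where "D k = ?M e1 e1 k * ?M e2 e2 k - ?M e1 e2 k * ?M e2 e1 k" for k
  have "open {k. D k \<noteq> 0}"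
    unfolding D_def by (intro open_Collect_neq continuous_intros smooth_map_continuous[OF smM])
  moreover have "D k0 = 1" by (simp add: D_def e)
  ultimately obtain r0 where r0: "r0 > 0" "ball k0 r0 \<subseteq> {k. D k \<noteq> 0}"
    by (metis (mono_tags, lifting) mem_Collect_eq openE zero_neq_one)
  \<comment> \<open>The three bounds keep \<open>D\<close> nonzero, keep reflected lattice copies of
    the ball away from it, and keep its integer translates disjoint.\<close>
  define r where "r = min r0 (min (d/2) (1/2))"
  have r: "r > 0" "r \<le> r0" "2 * r \<le> d" "r \<le> 1/2" using r0 d by (auto simp: r_def)
  have loc: "symmetrize (local_section k0 r u) k = bump k0 r k *\<^sub>R P k u" if k: "dist k0 k < r" for u k
  proof -
    let ?w = "local_section k0 r u"
    have "?w (- k - l) = 0" if l: "l \<in> int_vecs" for l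
    proof (rule ccontr)
      assume "?w (- k - l) \<noteq> 0"
      then have "dist k0 (- k - l) < r" using local_section_supp[OF r(1)] by blast
      \<comment> \<open>The two occurrences of \<open>k\<close> cancel, leaving the distance from
        \<open>k0 + k0\<close> to the lattice vector \<open>- l\<close>.\<close>
      then have "norm ((k0 - (- k - l)) + (k0 - k)) < 2 * r"
        using k norm_triangle_ineq[of "k0 - (- k - l)" "k0 - k"] by (simp add: dist_norm)
      then have "dist (k0 + k0) (- l) < d" using r by (simp add: dist_norm algebra_simps)
      then show False using d int_vecs_minus[OF l] by force
    qed
    then have "{l \<in> int_vecs. ?w (- k - l) \<noteq> 0} = {}" by blast
    then have "spread ?w (- k) = 0" by (simp only: spread_def sum.empty)
    moreover have "spread ?w k = ?w k"
      by (rule spread_on_ball[OF r(4) local_section_supp k]) (use r in auto)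
    ultimately show ?thesis by (simp add: symmetrize_def local_section_def linear_0[OF linear_\<Theta>])
  qed
  show ?thesis
  proof
    \<comment> \<open>Half the radius keeps the bump nonzero on the whole closed ball.\<close>
    show "r / 2 > 0" using r by simp
    fix K :: "(real^'d) set" assume K: "compact K" "nonvanishing K"
    obtain s where s: "smooth_map s" "bloch_section s" "\<forall>k\<in>K. s k \<noteq> 0"
      using K(2) by (auto simp: nonvanishing_def)
    obtain \<delta> where \<delta>: "\<delta> > 0" "\<forall>k\<in>K. \<delta> \<le> norm (s k)" using norm_bounded_below[OF K(1) s(1,3)] .
    let ?f = "\<lambda>x k. cinner J x (s k)" and ?b = "\<lambda>k. complex_of_real (bump k0 r k)"
    txt \<open>By Cramer's rule, \<open>h k\<close> is the only parameter whose perturbed section vanishes at \<open>k\<close>.\<close>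
    define h where "h k = (- (?M e2 e2 k * ?f e1 k - ?M e1 e2 k * ?f e2 k) / (?b k * D k),
                           - (?M e1 e1 k * ?f e2 k - ?M e2 e1 k * ?f e1 k) / (?b k * D k))" for k
    have nz: "bump k0 r k \<noteq> 0" "D k \<noteq> 0" if "k \<in> cball k0 (r / 2)" for k
    proof -
      have "dist k0 k < r" using that r by auto
      then have "bump k0 r k > 0" "k \<in> ball k0 r0" using r bump_pos_iff[of r k0 k] by auto
      then show "bump k0 r k \<noteq> 0" "D k \<noteq> 0" using r0(2) by auto
    qed
    have "h differentiable_on cball k0 (r / 2)"
      unfolding differentiable_on_def
    proof
      fix k assume k: "k \<in> cball k0 (r / 2)"
      have 1: "?f x differentiable (at k)" for x
        by (intro smooth_map_differentiable smooth_map_bounded_linear[OF bounded_linear_cinner] s)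
      have 2: "?b differentiable (at k)"
        by (intro smooth_map_differentiable smooth_map_bounded_linear[OF bounded_linear_of_real] smooth_map_bump)
      have 3: "?M x y differentiable (at k)" for x y
        by (intro smooth_map_differentiable smM)
      have "h differentiable (at k)"
        unfolding h_def[abs_def] D_def
        by (intro differentiable_Pair differentiable_divide differentiable_minus differentiable_diff
            differentiable_mult 1 2 3) (use nz[OF k] in \<open>simp_all add: D_def\<close>)
      then show "h differentiable (at k within cball k0 (r / 2))"
        by (rule differentiable_at_withinI)
    qed
    then have "negligible (h ` cball k0 (r / 2))"
      by (rule negligible_differentiable_image_lowdim[rotated]) (use dim in simp)
    \<comment> \<open>Parameters of norm below \<delta>/4 give \<open>norm u\<close> below
      \<delta>/2, hence a perturbation below the margin \<delta> on \<open>K\<close>.\<close>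
    moreover have "\<not> negligible (ball 0 (\<delta> / 4) :: (complex \<times> complex) set)"
      by (rule open_not_negligible) (use \<delta> in auto)
    ultimately have "\<not> ball 0 (\<delta> / 4) \<subseteq> h ` cball k0 (r / 2)" using negligible_subset by blast
    then obtain c1 c2 where c: "norm (c1, c2) < \<delta> / 4" "(c1, c2) \<notin> h ` cball k0 (r / 2)"
      by (auto simp: subset_iff)
    define u where "u = cscale J c1 e1 + cscale J c2 e2"
    have "norm u \<le> cmod c1 + cmod c2"
      unfolding u_def using norm_triangle_ineq[of "cscale J c1 e1" "cscale J c2 e2"] by (simp add: norm_cscale e)
    also have "\<dots> \<le> 2 * norm (c1, c2)" using norm_fst_le[of c1 c2] norm_snd_le[of c2 c1] by simp
    finally have u: "2 * norm u < \<delta>" using c(1) by simp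
    let ?t = "symmetrize (local_section k0 r u)"
    have "s k + ?t k \<noteq> 0" if "k \<in> K" for k
    proof
      assume "s k + ?t k = 0"
      then have "norm (s k) = norm (?t k)" by (metis add_eq_0_iff norm_minus_cancel)
      also have "\<dots> < \<delta>" using norm_symmetrize_local[of r k0 u k] r u by simp
      finally show False using \<delta> that by force
    qed
    moreover have "s k + ?t k \<noteq> 0" if k: "k \<in> cball k0 (r / 2)" for k
    proof
      assume 0: "s k + ?t k = 0"
      have "dist k0 k < r" using k r by auto
      then have "?t k = cscale J (?b k) (cscale J c1 (P k e1) + cscale J c2 (P k e2))"
        by (simp add: loc u_def linear_add[OF linear_P] P_cscale) (simp add: cscale_def)
      \<comment> \<open>Pairing a hypothetical zero with \<open>e1\<close> and \<open>e2\<close>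
        yields two linear equations in \<open>c1\<close> and \<open>c2\<close>, whose solution is
        \<open>h k\<close>.\<close>
      then have *: "?f x k + ?b k * (c1 * ?M x e1 k + c2 * ?M x e2 k) = 0" for x
        using arg_cong[OF 0, of "cinner J x"]
        by (simp add: cinner_add_right cinner_cscale_right algebra_simps)
      have f: "?f x k = - (?b k * (c1 * ?M x e1 k + c2 * ?M x e2 k))" for x
        using *[of x] by (simp add: eq_neg_iff_add_eq_0)
      have "- (?M e2 e2 k * ?f e1 k - ?M e1 e2 k * ?f e2 k) = c1 * (?b k * D k)"
        "- (?M e1 e1 k * ?f e2 k - ?M e2 e1 k * ?f e1 k) = c2 * (?b k * D k)"
        unfolding f D_def by algebra+
      then have "h k = (c1, c2)" using nz[OF k] by (simp add: h_def)
      then show False using c(2) k by force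
    qed
    ultimately show "nonvanishing (K \<union> cball k0 (r / 2))"
      unfolding nonvanishing_def
      by (intro exI[of _ "\<lambda>k. s k + ?t k"])
        (auto intro!: smooth_map_add bloch_section_add s smooth_symmetrize_local bloch_section_symmetrize_local r)
  qed
qed

lemma nonvanishing_UN:
  assumes "finite X" "compact K" "nonvanishing K" "\<And>x. x \<in> X \<Longrightarrow> compact (A x)"
    and "\<And>x K. x \<in> X \<Longrightarrow> compact K \<Longrightarrow> nonvanishing K \<Longrightarrow> nonvanishing (K \<union> A x)"
  shows "nonvanishing (K \<union> (\<Union>x\<in>X. A x))"
  using assms
proof (induction X)
  case (insert x X)
  have "nonvanishing (K \<union> (\<Union>x\<in>X. A x))" using insert by simp
  moreover have "compact (K \<union> (\<Union>x\<in>X. A x))" using insert by (intro compact_Un compact_UN) auto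
  ultimately have "nonvanishing (K \<union> (\<Union>x\<in>X. A x) \<union> A x)" using insert.prems by blast
  then show ?case by (simp add: Un_ac)
qed simp

text \<open>Fixed points are treated first. The zeros that remain in the cube then form a compact
  set \<open>C\<close> free of fixed points, so finitely many free-point balls cover it. The second
  pass starts from the cube minus these open balls, where the first section is already
  nonzero.\<close>

lemma nonvanishing_section_rank_ge_2:
  assumes m: "m = Suc (Suc n)" and dim: "CARD('d) \<le> 3"
  obtains s where "smooth_map s" "bloch_section s" "\<And>k. s k \<noteq> 0"
proof -
  let ?X = "{k \<in> cbox 0 1 :: (real^'d) set. k + k \<in> int_vecs}"
  have "bloch_section (\<lambda>k. 0)"
    by (simp add: bloch_section_def linear_0[OF linear_P] linear_0[OF linear_\<Theta>] \<tau>_zero)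
  then have "nonvanishing {}" unfolding nonvanishing_def using smooth_map_const by blast
  then have "nonvanishing ({} \<union> (\<Union>x\<in>?X. {x}))"
    using nonvanishing_insert_fixed_point[OF _ m] by (intro nonvanishing_UN finite_fixed_points) auto
  then obtain s where s: "smooth_map s" "bloch_section s" "\<forall>k\<in>?X. s k \<noteq> 0"
    by (auto simp: nonvanishing_def)
  have U: "open {k. s k \<noteq> 0}"
    by (intro open_Collect_neq continuous_on_const smooth_map_continuous s)
  define C where "C = cbox 0 1 - {k. s k \<noteq> 0}"
  have C: "compact C" unfolding C_def by (intro compact_diff compact_cbox U)
  have "\<exists>\<rho>>0. \<forall>K. compact K \<longrightarrow> nonvanishing K \<longrightarrow> nonvanishing (K \<union> cball k \<rho>)" if "k \<in> C" for k
  proof -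
    have "k + k \<notin> int_vecs" using that s(3) by (auto simp: C_def)
    then show ?thesis using nonvanishing_extend_free_point[OF _ m dim] by metis
  qed
  then obtain \<rho> where \<rho>: "\<And>k. k \<in> C \<Longrightarrow> \<rho> k > 0"
    "\<And>k K. k \<in> C \<Longrightarrow> compact K \<Longrightarrow> nonvanishing K \<Longrightarrow> nonvanishing (K \<union> cball k (\<rho> k))"
    by metis
  obtain F where F: "F \<subseteq> C" "finite F" "C \<subseteq> (\<Union>k\<in>F. ball k (\<rho> k))"
  proof (rule compactE_image[OF C])
    show "C \<subseteq> (\<Union>k\<in>C. ball k (\<rho> k))" using \<rho>(1) by force
  qed auto
  let ?K = "cbox 0 1 - (\<Union>k\<in>F. ball k (\<rho> k))"
  have "compact ?K" by (intro compact_diff compact_cbox open_UN) auto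
  moreover have "nonvanishing ?K"
    unfolding nonvanishing_def using s F(3) by (intro exI[of _ s]) (auto simp: C_def)
  ultimately have "nonvanishing (?K \<union> (\<Union>k\<in>F. cball k (\<rho> k)))"
    using F \<rho>(2) by (intro nonvanishing_UN) auto
  moreover have "cbox 0 1 \<subseteq> ?K \<union> (\<Union>k\<in>F. cball k (\<rho> k))"
    using ball_subset_cball by fastforce
  ultimately obtain s where s: "smooth_map s" "bloch_section s" "\<forall>k\<in>cbox 0 1. s k \<noteq> 0"
    unfolding nonvanishing_def by (meson subsetD)
  show ?thesis by (rule that[OF s(1,2) bloch_section_nonzero_UNIV[OF s(2,3)]])
qed

end

section \<open>Rank one: transport and phase matching\<close>

text \<open>The slabs are closed and infinite in number, so they cannot be glued at once. Each open
  set \<open>?A n\<close> lies in three neighbouring slabs, and the open sets cover the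
  space.\<close>

lemma continuous_on_slabs:
  fixes f :: "real^'d \<Rightarrow> 'b::topological_space"
  assumes "\<And>n::int. continuous_on {k. \<bar>k $ j - of_int n\<bar> \<le> 1/2} f"
  shows "continuous_on UNIV f"
proof -
  let ?S = "\<lambda>n::int. {k::real^'d. \<bar>k $ j - of_int n\<bar> \<le> 1/2}"
  let ?A = "\<lambda>n::int. {k::real^'d. of_int n - 1 < k $ j \<and> k $ j < of_int n + 1}"
  have cl: "closed (?S n)" for n by (intro closed_Collect_le continuous_intros)
  have "continuous_on (?A n) f" for n
  proof -
    have "continuous_on (?S (n - 1) \<union> ?S n \<union> ?S (n + 1)) f"
      by (intro continuous_on_closed_Un closed_Un cl assms)
    moreover have "?A n \<subseteq> ?S (n - 1) \<union> ?S n \<union> ?S (n + 1)"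
    proof
      fix k assume "k \<in> ?A n"
      then have "\<bar>k $ j - of_int (n - 1)\<bar> \<le> 1/2 \<or> \<bar>k $ j - of_int n\<bar> \<le> 1/2 \<or> \<bar>k $ j - of_int (n + 1)\<bar> \<le> 1/2"
        by (simp add: abs_if) linarith
      then show "k \<in> ?S (n - 1) \<union> ?S n \<union> ?S (n + 1)" by blast
    qed
    ultimately show ?thesis by (rule continuous_on_subset)
  qed
  moreover have "open (?A n)" for n
    by (intro open_Collect_conj open_Collect_less continuous_intros)
  ultimately have "continuous_on (\<Union>n. ?A n) f" by (intro continuous_on_open_UN) auto
  moreover have "(\<Union>n. ?A n) = UNIV"
  proof (intro equalityI subsetI)
    fix k :: "real^'d"
    have "k \<in> ?A \<lfloor>k $ j\<rfloor>" by (simp add: floor_correct) linarith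
    then show "k \<in> (\<Union>n. ?A n)" by blast
  qed simp
  ultimately show ?thesis by simp
qed

text \<open>The difference of the lifts divided by \<open>2 * pi\<close> is continuous and
  integer-valued on a connected space, hence constant.\<close>

lemma continuous_lift_unique:
  fixes \<theta> \<eta> :: "'a::real_normed_vector \<Rightarrow> real"
  assumes "continuous_on UNIV \<theta>" "continuous_on UNIV \<eta>" "\<And>x. cis (\<theta> x) = cis (\<eta> x)" "\<theta> a = \<eta> a"
  shows "\<theta> x = \<eta> x"
proof -
  define f where "f x = (\<theta> x - \<eta> x) / (2 * pi)" for x
  have f_int: "f x \<in> \<int>" for x
  proof -
    have "cis (\<theta> x - \<eta> x) = 1" using assms(3)[of x] by (simp flip: cis_divide)
    then have "cos (\<theta> x - \<eta> x) = 1" by (metis cis.sel(1) one_complex.sel(1))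
    then obtain n :: int where "\<theta> x - \<eta> x = n * 2 * pi" by (auto simp: cos_one_2pi_int)
    then show ?thesis by (simp add: f_def)
  qed
  have "f constant_on UNIV"
  proof (rule continuous_discrete_range_constant)
    show "connected (UNIV :: 'a set)" by (simp add: convex_connected)
    show "continuous_on UNIV f" unfolding f_def by (intro continuous_intros assms) auto
    fix x
    have "1 \<le> norm (f y - f x)" if "f y \<noteq> f x" for y
      using Ints_nonzero_abs_ge1[of "f y - f x"] f_int that by simp
    then show "\<exists>e>0. \<forall>y. y \<in> UNIV \<and> f y \<noteq> f x \<longrightarrow> e \<le> norm (f y - f x)" by (intro exI[of _ 1]) auto
  qed
  then have "f x = f a" by (auto simp: constant_on_def)
  then show ?thesis using assms(4) by (simp add: f_def)
qed

definition restrict_coords :: "'d set \<Rightarrow> real^'d \<Rightarrow> real^'d" where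
  "restrict_coords S k = (\<chi> i. if i \<in> S then k $ i else 0)"

lemma restrict_coords_add: "restrict_coords S (k + l) = restrict_coords S k + restrict_coords S l"
  and restrict_coords_minus: "restrict_coords S (- k) = - restrict_coords S k"
  and restrict_coords_empty: "restrict_coords {} k = 0"
  and restrict_coords_UNIV: "restrict_coords UNIV k = k"
  and restrict_coords_int_vecs: "l \<in> int_vecs \<Longrightarrow> restrict_coords S l \<in> int_vecs"
  by (auto simp: restrict_coords_def vec_eq_iff int_vecs_def)

lemma restrict_coords_insert:
  "j \<notin> S \<Longrightarrow> restrict_coords (insert j S) k = restrict_coords S k + (k $ j) *\<^sub>R axis j 1"
  by (auto simp: restrict_coords_def vec_eq_iff axis_def)

lemma continuous_on_restrict_coords: "continuous_on A (restrict_coords S)"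
  unfolding restrict_coords_def[abs_def]
proof (rule continuous_on_vec_lambda)
  fix i show "continuous_on A (\<lambda>k. if i \<in> S then k $ i else 0)"
    by (cases "i \<in> S") (auto intro!: continuous_intros)
qed

lemma axis_int_vecs: "of_int n *\<^sub>R axis j 1 \<in> int_vecs"
  by (auto simp: int_vecs_def axis_def)

context bloch_family begin

lemma rank_one_eq:
  assumes m: "m = Suc 0" and u: "P k u = u" "norm u = 1" and x: "P k x = x"
  shows "x = cscale J (cinner J u x) u"
proof -
  have "cdim_eq J (range (\<lambda>x. P k x - dyad u x)) 0"
    by (rule cdim_eq_diff_dyad[OF projector u]) (use rank[of k] m in simp)
  then have "range (\<lambda>x. P k x - dyad u x) = {0}" by (rule cdim_eq_0)
  then have "P k x - dyad u x = 0" by blast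
  then show ?thesis using x by (simp add: dyad_def)
qed

text \<open>Joint continuity follows from continuity for a fixed vector together with the uniform
  bound \<open>norm_P\<close>.\<close>

lemma continuous_on_P:
  fixes f :: "'t::topological_space \<Rightarrow> real^'d"
  assumes f: "continuous_on S f" and g: "continuous_on S g"
  shows "continuous_on S (\<lambda>x. P (f x) (g x))"
  unfolding continuous_on_def
proof
  fix a assume a: "a \<in> S"
  have "continuous_on S (\<lambda>x. P (f x) (g a))"
    by (rule continuous_on_compose2[OF smooth_map_continuous[OF smooth] f]) auto
  then have 1: "((\<lambda>x. P (f x) (g a)) \<longlongrightarrow> P (f a) (g a)) (at a within S)"
    using a by (simp add: continuous_on_def)
  have "((\<lambda>x. g x - g a) \<longlongrightarrow> 0) (at a within S)"
    using g a by (simp add: continuous_on_def LIM_zero)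
  then have 2: "((\<lambda>x. P (f x) (g x - g a)) \<longlongrightarrow> 0) (at a within S)"
    by (rule tendsto_0_le[where K=1]) (simp add: norm_P)
  from tendsto_add[OF 1 2] show "((\<lambda>x. P (f x) (g x)) \<longlongrightarrow> P (f a) (g a)) (at a within S)"
    by (simp add: linear_diff[OF linear_P])
qed

text \<open>The distance \<delta> is a Lebesgue number for a cover of the unit cube by sets on which
  \<open>P\<close> nearly fixes a given unit vector. Translation carries the estimate to all of
  space.\<close>

lemma uniform_overlap:
  assumes m: "m = Suc 0"
  obtains \<delta> where "\<delta> > 0" "\<And>k l x. dist k l < \<delta> \<Longrightarrow> P k x = x \<Longrightarrow> x \<noteq> 0 \<Longrightarrow> P l x \<noteq> 0"
proof -
  have "\<forall>q. \<exists>e. P q e = e \<and> norm e = 1"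
    using cdim_eq_Suc_unit[OF projector] rank m by metis
  then obtain e where e: "\<And>q. P q (e q) = e q" "\<And>q. norm (e q) = 1" by metis
  \<comment> \<open>The constant 1/4 leaves an inner product of at least 1 - 1/4 - 1/4 - 1/16 > 0 in
    the estimate below.\<close>
  define U where "U q = {k. dist (P k (e q)) (e q) < 1/4}" for q
  have overlap: "P l x \<noteq> 0" if kl: "k \<in> U q" "l \<in> U q" and x: "P k x = x" "x \<noteq> 0" for k l q x
  proof
    assume 0: "P l x = 0"
    \<comment> \<open>In rank one \<open>x\<close> is a nonzero multiple of the normalised
      \<open>y\<close>, so \<open>P l\<close> would kill \<open>y\<close> as well and make
      \<open>P l (e q)\<close> orthogonal to \<open>y\<close>. Both vectors are close to
      \<open>e q\<close>, which rules this out.\<close>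
    define y where "y = P k (e q)"
    have y_near: "norm (y - e q) < 1/4" "norm (P l (e q) - e q) < 1/4"
      using kl by (auto simp: U_def y_def dist_norm)
    have "y \<noteq> 0" using y_near e(2)[of q] by auto
    define u where "u = y /\<^sub>R norm y"
    have u: "P k u = u" "norm u = 1" using \<open>y \<noteq> 0\<close>
      by (auto simp: u_def y_def linear_scale[OF linear_P] P_P)
    define z where "z = cinner J u x"
    have xz: "x = cscale J z u" unfolding z_def by (rule rank_one_eq[OF m u x(1)])
    then have "z \<noteq> 0" using x by auto
    moreover have "cscale J z (P l u) = 0" using 0 xz by (simp add: P_cscale)
    then have "cmod z * norm (P l u) = 0" by (metis norm_cscale norm_zero)
    ultimately have "P l u = 0" by simp
    then have "P l y = 0" using \<open>y \<noteq> 0\<close> by (simp add: u_def linear_scale[OF linear_P])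
    then have "P l (e q) \<bullet> y = 0" by (simp add: P_inner)
    moreover have "P l (e q) \<bullet> y = 1 + e q \<bullet> (y - e q) + (P l (e q) - e q) \<bullet> e q + (P l (e q) - e q) \<bullet> (y - e q)"
      using e(2)[of q] by (simp add: norm_eq_1 inner_diff_left inner_diff_right)
    moreover have "\<bar>e q \<bullet> (y - e q)\<bar> \<le> 1/4"
      using Cauchy_Schwarz_ineq2[of "e q" "y - e q"] y_near e(2)[of q] by simp
    moreover have "\<bar>(P l (e q) - e q) \<bullet> e q\<bar> \<le> 1/4"
      using Cauchy_Schwarz_ineq2[of "P l (e q) - e q" "e q"] y_near e(2)[of q] by simp
    moreover have "\<bar>(P l (e q) - e q) \<bullet> (y - e q)\<bar> \<le> 1/4 * (1/4)"
      using Cauchy_Schwarz_ineq2[of "P l (e q) - e q" "y - e q"]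
        mult_mono[of "norm (P l (e q) - e q)" "1/4" "norm (y - e q)" "1/4"] y_near by simp
    ultimately show False by linarith
  qed
  obtain \<delta> where \<delta>: "\<delta> > 0" "\<And>k. k \<in> cbox 0 1 \<Longrightarrow> \<exists>G\<in>range U. ball k \<delta> \<subseteq> G"
  proof (rule Heine_Borel_lemma[OF compact_cbox[of "0::real^'d" 1], of "range U"])
    have "q \<in> U q" for q using e by (simp add: U_def)
    then show "cbox 0 1 \<subseteq> \<Union> (range U)" by blast
    show "open G" if "G \<in> range U" for G
      using that unfolding U_def
      by (auto intro!: open_Collect_less continuous_intros smooth_map_continuous[OF smooth])
  qed blast
  show ?thesis
  proof
    show "\<delta> > 0" by fact
    fix k l x assume kl: "dist k l < \<delta>" and x: "P k x = x" "x \<noteq> 0"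
    obtain n where n: "n \<in> int_vecs" "k - n \<in> cbox 0 1" by (rule ex_int_vec_unit_cube)
    obtain q where q: "ball (k - n) \<delta> \<subseteq> U q" using \<delta> n by blast
    have in_U: "k - n \<in> U q" "l - n \<in> U q" using q kl \<delta>(1) by (auto simp: subset_iff dist_norm)
    have tr: "P (p - n) (\<tau> (- n) x) = \<tau> (- n) (P p x)" for p
      using translate[OF int_vecs_minus[OF n(1)], of p x] by simp
    have "P (l - n) (\<tau> (- n) x) \<noteq> 0"
    proof (rule overlap[OF in_U])
      show "P (k - n) (\<tau> (- n) x) = \<tau> (- n) x" using tr x by simp
      show "\<tau> (- n) x \<noteq> 0" using norm_\<tau>[OF int_vecs_minus[OF n(1)], of x] x by auto
    qed
    then show "P l x \<noteq> 0" using tr[of l] \<tau>_zero[OF int_vecs_minus[OF n(1)]] by auto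
  qed
qed

text \<open>
  A fixed number of steps whose length is proportional to the distance travelled makes the transported
  vector depend continuously on the end point without any gluing.
\<close>

primrec transport :: "real^'d \<Rightarrow> real^'d \<Rightarrow> 'h \<Rightarrow> nat \<Rightarrow> 'h" where
  "transport q v x 0 = x"
| "transport q v x (Suc i) = P (q + real (Suc i) *\<^sub>R v) (transport q v x i)"

lemma transport_translate:
  "l \<in> int_vecs \<Longrightarrow> transport (q + l) v (\<tau> l x) i = \<tau> l (transport q v x i)"
proof (induction i)
  case (Suc i)
  have "q + l + real (Suc i) *\<^sub>R v = (q + real (Suc i) *\<^sub>R v) + l" by simp
  then show ?case using Suc translate by (simp only: transport.simps)
qed simp

lemma transport_reflect: "transport (- q) (- v) (\<Theta> x) i = \<Theta> (transport q v x i)"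
proof (induction i)
  case (Suc i)
  have "- q + real (Suc i) *\<^sub>R - v = - (q + real (Suc i) *\<^sub>R v)" by simp
  then show ?case using Suc reflect by (simp only: transport.simps)
qed simp

lemma transport_in_range: "P q x = x \<Longrightarrow> P (q + real i *\<^sub>R v) (transport q v x i) = transport q v x i"
  by (cases i) (simp_all add: P_P)

lemma transport_nonzero:
  assumes \<delta>: "\<And>k l x. dist k l < \<delta> \<Longrightarrow> P k x = x \<Longrightarrow> x \<noteq> 0 \<Longrightarrow> P l x \<noteq> 0"
    and v: "norm v < \<delta>" and x: "P q x = x" "x \<noteq> 0"
  shows "transport q v x i \<noteq> 0"
proof (induction i)
  case (Suc i)
  have "dist (q + real i *\<^sub>R v) (q + real (Suc i) *\<^sub>R v) < \<delta>"
    using v by (simp add: dist_norm scaleR_add_left)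
  then show ?case using \<delta> transport_in_range[OF x(1)] Suc unfolding transport.simps by blast
qed (use x in simp)

lemma continuous_on_transport:
  fixes f :: "'t::topological_space \<Rightarrow> real^'d"
  assumes "continuous_on S f" "continuous_on S g" "continuous_on S h"
  shows "continuous_on S (\<lambda>z. transport (f z) (g z) (h z) i)"
proof (induction i)
  case (Suc i)
  show ?case unfolding transport.simps
    by (intro continuous_on_P continuous_intros assms Suc)
qed (use assms in simp)

text \<open>
  Sections of the pullback of the line bundle \<open>Ran P\<close> along \<^term>\<open>restrict_coords S\<close>. Keeping all of
  \<open>\<real>\<^sup>d\<close> as domain allows an induction on \<open>S\<close> within one type.
\<close>

definition partial_section :: "'d set \<Rightarrow> (real^'d \<Rightarrow> 'h) \<Rightarrow> bool" where
  "partial_section S \<phi> \<longleftrightarrow> continuous_on UNIV \<phi> \<and> (\<forall>k. norm (\<phi> k) = 1) \<and>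
     (\<forall>k. P (restrict_coords S k) (\<phi> k) = \<phi> k) \<and>
     (\<forall>k. \<forall>l\<in>int_vecs. \<phi> (k + l) = \<tau> (restrict_coords S l) (\<phi> k)) \<and> (\<forall>k. \<phi> (- k) = \<Theta> (\<phi> k))"

text \<open>Transport starts at the centre \<open>t = 0\<close> of the cell and runs both ways, so
  compatibility with reversal, which sends \<open>(k, t)\<close> to \<open>(- k, - t)\<close>, is
  automatic.\<close>

lemma ex_transported_section:
  assumes m: "m = Suc 0" and \<phi>: "partial_section S \<phi>"
  obtains \<psi> :: "real^'d \<Rightarrow> real \<Rightarrow> 'h" where
    "continuous_on {z. \<bar>snd z\<bar> \<le> 1/2} (\<lambda>z. \<psi> (fst z) (snd z))"
    "\<And>k t. \<bar>t\<bar> \<le> 1/2 \<Longrightarrow> norm (\<psi> k t) = 1"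
    "\<And>k t. P (restrict_coords S k + t *\<^sub>R axis j 1) (\<psi> k t) = \<psi> k t"
    "\<And>k l t. l \<in> int_vecs \<Longrightarrow> \<psi> (k + l) t = \<tau> (restrict_coords S l) (\<psi> k t)"
    "\<And>k t. \<psi> (- k) (- t) = \<Theta> (\<psi> k t)"
proof -
  let ?E = "axis j 1 :: real^'d" and ?\<pi> = "restrict_coords S"
  have \<phi>': "continuous_on UNIV \<phi>" "\<And>k. norm (\<phi> k) = 1" "\<And>k. P (?\<pi> k) (\<phi> k) = \<phi> k"
    "\<And>k l. l \<in> int_vecs \<Longrightarrow> \<phi> (k + l) = \<tau> (?\<pi> l) (\<phi> k)" "\<And>k. \<phi> (- k) = \<Theta> (\<phi> k)"
    using \<phi> by (auto simp: partial_section_def)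
  obtain \<delta> where \<delta>: "\<delta> > 0" "\<And>k l x. dist k l < \<delta> \<Longrightarrow> P k x = x \<Longrightarrow> x \<noteq> 0 \<Longrightarrow> P l x \<noteq> 0"
    using uniform_overlap[OF m] by blast
  obtain N where N: "N \<noteq> 0" "1 / real N < \<delta>"
    using \<delta>(1) real_arch_inverse[of \<delta>] by (auto simp: inverse_eq_divide)
  \<comment> \<open>\<open>N\<close> steps of size \<open>t / N\<close> end exactly at parameter
    \<open>t\<close>, and for \<open>t\<close> in the cell each step is shorter than
    \<delta>.\<close>
  define T where "T k t = transport (?\<pi> k) ((t / real N) *\<^sub>R ?E) (\<phi> k) N" for k t
  have T_nz: "T k t \<noteq> 0" if "\<bar>t\<bar> \<le> 1/2" for k t
    unfolding T_def
  proof (rule transport_nonzero[OF \<delta>(2)])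
    have "norm ((t / real N) *\<^sub>R ?E) = \<bar>t\<bar> / real N" by simp
    also have "\<dots> \<le> 1 / real N" using that by (intro divide_right_mono) auto
    also have "\<dots> < \<delta>" by (rule N)
    finally show "norm ((t / real N) *\<^sub>R ?E) < \<delta>" .
    show "P (?\<pi> k) (\<phi> k) = \<phi> k" by (rule \<phi>')
    show "\<phi> k \<noteq> 0" using \<phi>'(2)[of k] by auto
  qed
  have T_range: "P (?\<pi> k + t *\<^sub>R ?E) (T k t) = T k t" for k t
    using transport_in_range[OF \<phi>'(3), of k N "(t / real N) *\<^sub>R ?E"] N by (simp add: T_def)
  have T_tr: "T (k + l) t = \<tau> (?\<pi> l) (T k t)" if "l \<in> int_vecs" for k l t
    unfolding T_def restrict_coords_add \<phi>'(4)[OF that]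
    by (rule transport_translate[OF restrict_coords_int_vecs[OF that]])
  have T_re: "T (- k) (- t) = \<Theta> (T k t)" for k t
    using transport_reflect[of "?\<pi> k" "(t / real N) *\<^sub>R ?E" "\<phi> k" N]
    by (simp add: T_def restrict_coords_minus \<phi>'(5))
  have T_cont: "continuous_on A (\<lambda>z. T (fst z) (snd z))" for A
    unfolding T_def
    by (intro continuous_on_transport continuous_intros
        continuous_on_compose2[OF continuous_on_restrict_coords] continuous_on_compose2[OF \<phi>'(1)])
      (use N in auto)
  \<comment> \<open>Outside the cell \<open>T\<close> may vanish; the quotient is then 0 and the
    range and symmetry identities still hold, so they carry no bound on \<open>t\<close>.\<close>
  show ?thesis
  proof (rule that[of "\<lambda>k t. T k t /\<^sub>R norm (T k t)"])
    show "continuous_on {z. \<bar>snd z\<bar> \<le> 1/2} (\<lambda>z. T (fst z) (snd z) /\<^sub>R norm (T (fst z) (snd z)))"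
      by (intro continuous_intros T_cont) (use T_nz in auto)
    show "norm (T k t /\<^sub>R norm (T k t)) = 1" if "\<bar>t\<bar> \<le> 1/2" for k t
      using T_nz[OF that] by simp
    show "P (?\<pi> k + t *\<^sub>R ?E) (T k t /\<^sub>R norm (T k t)) = T k t /\<^sub>R norm (T k t)" for k t
      by (simp add: linear_scale[OF linear_P] T_range)
    show "T (k + l) t /\<^sub>R norm (T (k + l) t) = \<tau> (?\<pi> l) (T k t /\<^sub>R norm (T k t))"
      if "l \<in> int_vecs" for k l t
      using restrict_coords_int_vecs[OF that, of S]
      by (simp add: T_tr[OF that] norm_\<tau> linear_scale[OF linear_\<tau>])
    show "T (- k) (- t) /\<^sub>R norm (T (- k) (- t)) = \<Theta> (T k t /\<^sub>R norm (T k t))" for k t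
      by (simp add: T_re linear_scale[OF linear_\<Theta>])
  qed
qed

text \<open>The correcting phase respects reversal: \<open>t * \<theta> k\<close> is odd under
  \<open>(k, t) \<mapsto> (- k, - t)\<close> and \<open>\<Theta>\<close> conjugates scalars. Between
  the two ends of the cell it changes by exactly \<open>\<theta> k\<close>, the mismatch.\<close>

lemma ex_matched_section:
  assumes m: "m = Suc 0" and \<phi>: "partial_section S \<phi>"
  obtains \<xi> :: "real^'d \<Rightarrow> real \<Rightarrow> 'h" where
    "continuous_on {z. \<bar>snd z\<bar> \<le> 1/2} (\<lambda>z. \<xi> (fst z) (snd z))"
    "\<And>k t. \<bar>t\<bar> \<le> 1/2 \<Longrightarrow> norm (\<xi> k t) = 1"
    "\<And>k t. P (restrict_coords S k + t *\<^sub>R axis j 1) (\<xi> k t) = \<xi> k t"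
    "\<And>k l t. l \<in> int_vecs \<Longrightarrow> \<xi> (k + l) t = \<tau> (restrict_coords S l) (\<xi> k t)"
    "\<And>k t. \<xi> (- k) (- t) = \<Theta> (\<xi> k t)"
    "\<And>k. \<tau> (axis j 1) (\<xi> k (- (1/2))) = \<xi> k (1/2)"
proof -
  let ?E = "axis j 1 :: real^'d" and ?\<pi> = "restrict_coords S" and ?h = "1/2 :: real"
  have E: "?E \<in> int_vecs" using axis_int_vecs[of 1 j] by simp
  obtain \<psi> :: "real^'d \<Rightarrow> real \<Rightarrow> 'h" where
    cont: "continuous_on {z. \<bar>snd z\<bar> \<le> 1/2} (\<lambda>z. \<psi> (fst z) (snd z))" and
    nrm: "\<And>k t. \<bar>t\<bar> \<le> 1/2 \<Longrightarrow> norm (\<psi> k t) = 1" and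
    rng: "\<And>k t. P (?\<pi> k + t *\<^sub>R ?E) (\<psi> k t) = \<psi> k t" and
    tr: "\<And>k l t. l \<in> int_vecs \<Longrightarrow> \<psi> (k + l) t = \<tau> (?\<pi> l) (\<psi> k t)" and
    re: "\<And>k t. \<psi> (- k) (- t) = \<Theta> (\<psi> k t)"
    using ex_transported_section[OF m \<phi>, of j] by blast
  define \<alpha> where "\<alpha> k = cinner J (\<psi> k ?h) (\<tau> ?E (\<psi> k (- ?h)))" for k
  have match: "\<tau> ?E (\<psi> k (- ?h)) = cscale J (\<alpha> k) (\<psi> k ?h)" for k
    unfolding \<alpha>_def
  proof (rule rank_one_eq[OF m rng nrm])
    have "?\<pi> k + ?h *\<^sub>R ?E = ?\<pi> k + (- ?h) *\<^sub>R ?E + ?E"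
      by (simp add: algebra_simps flip: scaleR_add_left)
    then show "P (?\<pi> k + ?h *\<^sub>R ?E) (\<tau> ?E (\<psi> k (- ?h))) = \<tau> ?E (\<psi> k (- ?h))"
      by (simp only: translate[OF E] rng)
  qed simp
  have \<alpha>_norm: "cmod (\<alpha> k) = 1" for k
    using arg_cong[OF match, of norm, of k] nrm[of ?h k] nrm[of "- ?h" k] by (simp add: norm_cscale norm_\<tau>[OF E])
  have \<alpha>_periodic: "\<alpha> (k + l) = \<alpha> k" if "l \<in> int_vecs" for k l
  proof -
    have l': "?\<pi> l \<in> int_vecs" by (rule restrict_coords_int_vecs[OF that])
    have "\<tau> ?E (\<tau> (?\<pi> l) x) = \<tau> (?\<pi> l) (\<tau> ?E x)" for x
      using \<tau>_\<tau>[OF E l', of x] \<tau>_\<tau>[OF l' E, of x] by (simp add: add.commute)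
    then show ?thesis by (simp add: \<alpha>_def tr[OF that] cinner_\<tau>[OF l'])
  qed
  \<comment> \<open>Reversal swaps the two ends of the cell and also swaps the arguments of the
    inner product; the two effects cancel.\<close>
  have \<alpha>_even: "\<alpha> (- k) = \<alpha> k" for k
  proof -
    have "\<alpha> (- k) = cinner J (\<Theta> (\<psi> k (- ?h))) (\<tau> ?E (\<Theta> (\<psi> k ?h)))"
      using re[of k "- ?h"] re[of k ?h] by (simp add: \<alpha>_def)
    also have "\<tau> ?E (\<Theta> (\<psi> k ?h)) = \<Theta> (\<tau> (- ?E) (\<psi> k ?h))"
      using \<Theta>_\<tau>[OF int_vecs_minus[OF E]] by simp
    also have "cinner J (\<Theta> (\<psi> k (- ?h))) \<dots> = cinner J (\<tau> (- ?E) (\<psi> k ?h)) (\<psi> k (- ?h))"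
      by (rule cinner_\<Theta>)
    also have "\<dots> = cinner J (\<tau> ?E (\<tau> (- ?E) (\<psi> k ?h))) (\<tau> ?E (\<psi> k (- ?h)))"
      by (simp only: cinner_\<tau>[OF E])
    also have "\<dots> = \<alpha> k" by (simp only: \<tau>_minus(2)[OF E] \<alpha>_def)
    finally show ?thesis .
  qed
  have \<psi>_cont: "continuous_on UNIV (\<lambda>k. \<psi> k t)" if "\<bar>t\<bar> \<le> 1/2" for t
  proof -
    have "continuous_on UNIV (\<lambda>k. \<psi> (fst (k, t)) (snd (k, t)))"
      by (rule continuous_on_compose2[OF cont]) (use that in \<open>auto intro!: continuous_intros\<close>)
    then show ?thesis by simp
  qed
  have "continuous_on UNIV \<alpha>"
    unfolding \<alpha>_def
    by (intro continuous_on_cinner bounded_linear.continuous_on[OF bounded_linear_\<tau>[OF E]] \<psi>_cont) auto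
  moreover have "\<alpha> k \<noteq> 0" for k using \<alpha>_norm[of k] by auto
  moreover have "contractible (UNIV :: (real^'d) set)" by (simp add: convex_imp_contractible)
  ultimately obtain g where g: "continuous_on UNIV g" "\<And>k. \<alpha> k = exp (g k)"
    using continuous_logarithm_on_contractible[of UNIV \<alpha>] by auto
  define \<theta> where "\<theta> k = Im (g k)" for k
  have \<theta>_cont: "continuous_on UNIV \<theta>" unfolding \<theta>_def by (intro continuous_intros g)
  have \<alpha>_cis: "\<alpha> k = cis (\<theta> k)" for k
  proof -
    have "exp (Re (g k)) = 1" using \<alpha>_norm[of k] g(2)[of k] by (simp add: norm_exp_eq_Re)
    then show ?thesis using g(2)[of k] by (simp add: exp_eq_polar \<theta>_def)
  qed
  have \<theta>_even: "\<theta> (- k) = \<theta> k" for k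
  proof (rule continuous_lift_unique[where \<theta> = "\<lambda>k. \<theta> (- k)" and a = 0])
    show "continuous_on UNIV (\<lambda>k. \<theta> (- k))"
      by (rule continuous_on_compose2[OF \<theta>_cont]) (auto intro!: continuous_intros)
    show "cis (\<theta> (- k)) = cis (\<theta> k)" for k using \<alpha>_even[of k] by (simp add: \<alpha>_cis)
  qed (use \<theta>_cont in auto)
  \<comment> \<open>At the base point \<open>- l/2\<close>, translation by \<open>l\<close>
    coincides with reflection, so evenness settles the integer ambiguity of the lift.\<close>
  have \<theta>_periodic: "\<theta> (k + l) = \<theta> k" if "l \<in> int_vecs" for k l
  proof (rule continuous_lift_unique[where \<theta> = "\<lambda>k. \<theta> (k + l)" and a = "(- (1/2)) *\<^sub>R l"])
    show "continuous_on UNIV (\<lambda>k. \<theta> (k + l))"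
      by (rule continuous_on_compose2[OF \<theta>_cont]) (auto intro!: continuous_intros)
    show "cis (\<theta> (k + l)) = cis (\<theta> k)" for k using \<alpha>_periodic[OF that, of k] by (simp add: \<alpha>_cis)
    have "(- (1/2)) *\<^sub>R l + l = (- (1/2)) *\<^sub>R l + 1 *\<^sub>R l" by simp
    also have "\<dots> = - ((- (1/2)) *\<^sub>R l)" unfolding scaleR_add_left[symmetric] by simp
    finally show "\<theta> ((- (1/2)) *\<^sub>R l + l) = \<theta> ((- (1/2)) *\<^sub>R l)" using \<theta>_even by metis
  qed (rule \<theta>_cont)
  show ?thesis
  proof (rule that[of "\<lambda>k t. cscale J (cis (t * \<theta> k)) (\<psi> k t)"])
    show "continuous_on {z. \<bar>snd z\<bar> \<le> 1/2} (\<lambda>z. cscale J (cis (snd z * \<theta> (fst z))) (\<psi> (fst z) (snd z)))"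
      by (intro continuous_on_cscale cont continuous_intros continuous_on_compose2[OF \<theta>_cont]) auto
    show "norm (cscale J (cis (t * \<theta> k)) (\<psi> k t)) = 1" if "\<bar>t\<bar> \<le> 1/2" for k t
      using nrm[OF that] by (simp add: norm_cscale)
    show "P (?\<pi> k + t *\<^sub>R ?E) (cscale J (cis (t * \<theta> k)) (\<psi> k t)) = cscale J (cis (t * \<theta> k)) (\<psi> k t)" for k t
      by (simp add: P_cscale rng)
    show "cscale J (cis (t * \<theta> (k + l))) (\<psi> (k + l) t) = \<tau> (?\<pi> l) (cscale J (cis (t * \<theta> k)) (\<psi> k t))"
      if "l \<in> int_vecs" for k l t
      by (simp add: \<theta>_periodic[OF that] tr[OF that] \<tau>_cscale restrict_coords_int_vecs[OF that])
    show "cscale J (cis (- t * \<theta> (- k))) (\<psi> (- k) (- t)) = \<Theta> (cscale J (cis (t * \<theta> k)) (\<psi> k t))" for k t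
      by (simp add: \<theta>_even re \<Theta>_cscale cis_cnj)
    fix k
    have "cis (- (1/2) * \<theta> k) * cis (\<theta> k) = cis (1/2 * \<theta> k)"
      by (simp add: cis_mult)
    then show "\<tau> ?E (cscale J (cis (- (1/2) * \<theta> k)) (\<psi> k (- (1/2)))) = cscale J (cis (1/2 * \<theta> k)) (\<psi> k (1/2))"
      by (simp only: \<tau>_cscale[OF E] match cscale_cscale \<alpha>_cis)
  qed
qed

text \<open>The section on the cell centred at \<open>n\<close> is the translated copy
  \<open>F n\<close>, and matching makes neighbouring copies agree on the common face. By
  \<open>\<phi>'_F\<close> any cell containing the point may be used, not only the one chosen by
  \<open>round\<close>; at \<open>- k\<close> the cell \<open>- n\<close> is convenient even on a
  face.\<close>

lemma partial_section_insert:
  assumes m: "m = Suc 0" and \<phi>: "partial_section S \<phi>" and j: "j \<notin> S"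
  obtains \<phi>' where "partial_section (insert j S) \<phi>'"
proof -
  let ?E = "axis j 1 :: real^'d" and ?\<pi> = "restrict_coords S" and ?\<pi>' = "restrict_coords (insert j S)"
  obtain \<xi> :: "real^'d \<Rightarrow> real \<Rightarrow> 'h" where
    cont: "continuous_on {z. \<bar>snd z\<bar> \<le> 1/2} (\<lambda>z. \<xi> (fst z) (snd z))" and
    nrm: "\<And>k t. \<bar>t\<bar> \<le> 1/2 \<Longrightarrow> norm (\<xi> k t) = 1" and
    rng: "\<And>k t. P (?\<pi> k + t *\<^sub>R ?E) (\<xi> k t) = \<xi> k t" and
    tr: "\<And>k l t. l \<in> int_vecs \<Longrightarrow> \<xi> (k + l) t = \<tau> (?\<pi> l) (\<xi> k t)" and
    re: "\<And>k t. \<xi> (- k) (- t) = \<Theta> (\<xi> k t)" and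
    match: "\<And>k. \<tau> ?E (\<xi> k (- (1/2))) = \<xi> k (1/2)"
    using ex_matched_section[OF m \<phi>, of j] by blast
  have E: "of_int n *\<^sub>R ?E \<in> int_vecs" for n :: int by (rule axis_int_vecs)
  define F where "F n k = \<tau> (of_int n *\<^sub>R ?E) (\<xi> k (k $ j - of_int n))" for n :: int and k
  define \<phi>' where "\<phi>' k = F (round (k $ j)) k" for k
  have F_Suc: "F (n + 1) k = F n k" if "k $ j - of_int n = 1/2" for n k
  proof -
    have "\<tau> (of_int (n + 1) *\<^sub>R ?E) x = \<tau> (of_int n *\<^sub>R ?E) (\<tau> ?E x)" for x
      using \<tau>_\<tau>[OF E[of n] E[of 1], of x] by (simp add: scaleR_add_left)
    moreover have "k $ j - of_int (n + 1) = - (1/2)" using that by simp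
    ultimately show ?thesis unfolding F_def by (simp only: match that)
  qed
  have round_le: "\<bar>x - of_int (round x)\<bar> \<le> 1/2" for x :: real
    using of_int_round_abs_le[of x] by (simp add: abs_minus_commute)
  have \<phi>'_F: "\<phi>' k = F n k" if n: "\<bar>k $ j - of_int n\<bar> \<le> 1/2" for n k
  proof -
    define r where "r = round (k $ j)"
    have r: "\<bar>k $ j - of_int r\<bar> \<le> 1/2" unfolding r_def by (rule round_le)
    \<comment> \<open>Two cells containing the same point are equal or adjacent, and in the adjacent
      case the point lies on their common face.\<close>
    then have "\<bar>of_int (n - r) :: real\<bar> \<le> 1" using n by linarith
    then have "\<bar>n - r\<bar> \<le> 1" by linarith
    then consider "n = r" | "n = r + 1" | "r = n + 1" by linarith
    then have "F r k = F n k"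
    proof cases
      case 2
      then have "k $ j - of_int r = 1/2" using n r by (simp add: abs_le_iff)
      then show ?thesis using F_Suc[of k r] 2 by simp
    next
      case 3
      then have "k $ j - of_int n = 1/2" using n r by (simp add: abs_le_iff)
      then show ?thesis using F_Suc[of k n] 3 by simp
    qed simp
    then show ?thesis by (simp add: \<phi>'_def r_def)
  qed
  have "partial_section (insert j S) \<phi>'"
    unfolding partial_section_def
  proof (intro conjI allI ballI)
    show "continuous_on UNIV \<phi>'"
    proof (rule continuous_on_slabs)
      fix n :: int
      let ?p = "\<lambda>k. (k, k $ j - of_int n)"
      have "continuous_on {k. \<bar>k $ j - of_int n\<bar> \<le> 1/2} (\<lambda>k. \<xi> (fst (?p k)) (snd (?p k)))"
        by (rule continuous_on_compose2[OF cont]) (auto intro!: continuous_intros)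
      then have "continuous_on {k. \<bar>k $ j - of_int n\<bar> \<le> 1/2} (\<lambda>k. \<xi> k (k $ j - of_int n))"
        by (simp only: fst_conv snd_conv)
      then have "continuous_on {k. \<bar>k $ j - of_int n\<bar> \<le> 1/2} (F n)"
        unfolding F_def by (intro bounded_linear.continuous_on[OF bounded_linear_\<tau>[OF E]])
      then show "continuous_on {k. \<bar>k $ j - of_int n\<bar> \<le> 1/2} \<phi>'"
        by (rule continuous_on_eq) (simp add: \<phi>'_F)
    qed
  next
    fix k :: "real^'d"
    define n where "n = round (k $ j)"
    have n: "\<bar>k $ j - of_int n\<bar> \<le> 1/2" unfolding n_def by (rule round_le)
    have \<phi>'_k: "\<phi>' k = F n k" by (rule \<phi>'_F[OF n])
    show "norm (\<phi>' k) = 1" unfolding \<phi>'_k F_def using nrm[OF n] by (simp add: norm_\<tau>[OF E])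
    have "?\<pi>' k = ?\<pi> k + (k $ j - of_int n) *\<^sub>R ?E + of_int n *\<^sub>R ?E"
      by (simp add: restrict_coords_insert[OF j] scaleR_diff_left)
    then show "P (?\<pi>' k) (\<phi>' k) = \<phi>' k"
      unfolding \<phi>'_k F_def by (simp only: translate[OF E] rng)
    have "\<phi>' (- k) = F (- n) (- k)" by (rule \<phi>'_F) (use n in \<open>simp add: abs_minus_commute\<close>)
    also have "\<dots> = \<tau> (- (of_int n *\<^sub>R ?E)) (\<xi> (- k) (- (k $ j - of_int n)))"
      by (simp add: F_def)
    also have "\<dots> = \<Theta> (\<phi>' k)"
      unfolding re \<phi>'_k F_def by (rule \<Theta>_\<tau>[OF E, symmetric])
    finally show "\<phi>' (- k) = \<Theta> (\<phi>' k)" .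
    fix l :: "real^'d" assume l: "l \<in> int_vecs"
    then obtain i :: int where i: "l $ j = of_int i" by (auto simp: int_vecs_def elim: Ints_cases)
    have l': "?\<pi> l \<in> int_vecs" by (rule restrict_coords_int_vecs[OF l])
    have "\<phi>' (k + l) = F (n + i) (k + l)" by (rule \<phi>'_F) (use n i in simp)
    also have "\<dots> = \<tau> (of_int (n + i) *\<^sub>R ?E) (\<tau> (?\<pi> l) (\<xi> k (k $ j - of_int n)))"
      by (simp add: F_def i tr[OF l])
    also have "\<dots> = \<tau> (?\<pi>' l + of_int n *\<^sub>R ?E) (\<xi> k (k $ j - of_int n))"
      unfolding \<tau>_\<tau>[OF E l'] by (simp add: restrict_coords_insert[OF j] i scaleR_add_left add_ac)
    also have "\<dots> = \<tau> (?\<pi>' l) (\<phi>' k)"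
      unfolding \<phi>'_k F_def by (simp only: \<tau>_\<tau>[OF restrict_coords_int_vecs[OF l] E])
    finally show "\<phi>' (k + l) = \<tau> (?\<pi>' l) (\<phi>' k)" .
  qed
  then show ?thesis by (rule that)
qed

text \<open>With no coordinates left the bundle is the single fibre at 0, where a constant unit
  vector fixed by \<open>\<Theta>\<close> serves.\<close>

lemma ex_partial_section:
  assumes m: "m = Suc 0"
  shows "\<exists>\<phi>. partial_section S \<phi>"
  using finite[of S]
proof (induction S)
  case empty
  obtain e where e: "P 0 e = e" "\<tau> 0 (\<Theta> e) = e" "e \<noteq> 0"
    by (rule ex_real_vector[of 0 0, OF _ _ m]) auto
  have "partial_section {} (\<lambda>k. e /\<^sub>R norm e)"
    unfolding partial_section_def
    using e by (auto simp: restrict_coords_empty linear_scale[OF linear_P] linear_scale[OF linear_\<Theta>] \<tau>_0)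
  then show ?case by blast
next
  case (insert j S)
  then show ?case using partial_section_insert[OF m] by metis
qed

lemma nonvanishing_section_rank_1:
  assumes m: "m = Suc 0"
  obtains s where "smooth_map s" "bloch_section s" "\<And>k. s k \<noteq> 0"
proof -
  obtain \<phi> where "partial_section UNIV \<phi>" using ex_partial_section[OF m] by blast
  then have "continuous_on UNIV \<phi>" "bloch_section \<phi>" "\<And>k. norm (\<phi> k) = 1"
    by (auto simp: partial_section_def bloch_section_def restrict_coords_UNIV)
  then show ?thesis using smooth_section_of_continuous that by blast
qed

end

section \<open>Symmetric frames\<close>

context bloch_family begin

lemma ex_unit_section:
  assumes m: "m = Suc n" and dim: "CARD('d) \<le> 3"
  obtains \<phi> where "smooth_map \<phi>" "bloch_section \<phi>" "\<And>k. norm (\<phi> k) = 1"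
proof (cases n)
  case 0
  then obtain s where "smooth_map s" "bloch_section s" "\<And>k. s k \<noteq> 0"
    using nonvanishing_section_rank_1 m by auto
  then show ?thesis using normalize_section that by blast
next
  case (Suc n')
  then obtain s where "smooth_map s" "bloch_section s" "\<And>k. s k \<noteq> 0"
    using nonvanishing_section_rank_ge_2[OF _ dim] m by auto
  then show ?thesis using normalize_section that by blast
qed

text \<open>The line spanned by a symmetric section is itself covariant and reversal-invariant, so
  its orthogonal complement in the fibre inherits all symmetries.\<close>

lemma bloch_family_diff_dyad:
  assumes m: "m = Suc n" and \<phi>: "smooth_map \<phi>" "bloch_section \<phi>" "\<And>k. norm (\<phi> k) = 1"
  shows "bloch_family J \<tau> \<Theta> (\<lambda>k x. P k x - dyad (\<phi> k) x) n"
proof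
  note \<phi>' = bloch_sectionD[OF \<phi>(2)]
  fix k x
  show "orth_projector J (\<lambda>x. P k x - dyad (\<phi> k) x)"
    by (rule orth_projector_diff_dyad[OF projector \<phi>'(1) \<phi>(3)])
  show "cdim_eq J (range (\<lambda>x. P k x - dyad (\<phi> k) x)) n"
    by (rule cdim_eq_diff_dyad[OF projector \<phi>'(1) \<phi>(3)]) (use rank[of k] m in simp)
  show "smooth_map (\<lambda>k. P k x - dyad (\<phi> k) x)"
    unfolding dyad_eq
    by (intro smooth_map_diff smooth smooth_map_add smooth_map_scaleR smooth_map_inner \<phi>(1)
        smooth_map_const smooth_map_bounded_linear[OF bounded_linear_J])
  show "P (- k) (\<Theta> x) - dyad (\<phi> (- k)) (\<Theta> x) = \<Theta> (P k x - dyad (\<phi> k) x)"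
    by (simp add: reflect \<phi>'(3) dyad_def cinner_\<Theta> linear_diff[OF linear_\<Theta>] \<Theta>_cscale flip: cinner_commute)
  fix l :: "real^'d" assume l: "l \<in> int_vecs"
  show "P (k + l) (\<tau> l x) - dyad (\<phi> (k + l)) (\<tau> l x) = \<tau> l (P k x - dyad (\<phi> k) x)"
    by (simp add: translate[OF l] \<phi>'(2)[OF l] dyad_def cinner_\<tau>[OF l] linear_diff[OF linear_\<tau>[OF l]] \<tau>_cscale[OF l])
qed

end

text \<open>Completeness is encoded as a resolution of \<open>P k\<close> into rank-one projectors.
  This gains one summand per induction step, and spanning follows from it.\<close>

definition (in bloch_family) symmetric_frame :: "(nat \<Rightarrow> real^'d \<Rightarrow> 'h) \<Rightarrow> bool" where
  "symmetric_frame \<phi> \<longleftrightarrow> (\<forall>a\<in>{1..m}. smooth_map (\<phi> a) \<and> bloch_section (\<phi> a)) \<and>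
     (\<forall>k. \<forall>a\<in>{1..m}. \<forall>b\<in>{1..m}. cinner J (\<phi> a k) (\<phi> b k) = (if a = b then 1 else 0)) \<and>
     (\<forall>k x. P k x = (\<Sum>a\<in>{1..m}. dyad (\<phi> a k) x))"

theorem ex_symmetric_frame:
  fixes P :: "real^'d \<Rightarrow> 'h::real_inner \<Rightarrow> 'h"
  assumes "bloch_family J \<tau> \<Theta> P m" and dim: "CARD('d) \<le> 3"
  shows "\<exists>\<phi>. bloch_family.symmetric_frame J \<tau> \<Theta> P m \<phi>"
  using assms(1)
proof (induction m arbitrary: P)
  case 0
  then interpret bloch_family J \<tau> \<Theta> P 0 .
  have "P k x = 0" for k x using cdim_eq_0[OF rank, of k] by blast
  then have "symmetric_frame (\<lambda>a k. 0)" unfolding symmetric_frame_def by simp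
  then show ?case by blast
next
  case (Suc m)
  then interpret bloch_family J \<tau> \<Theta> P "Suc m" by simp
  obtain \<psi> where \<psi>: "smooth_map \<psi>" "bloch_section \<psi>" "\<And>k. norm (\<psi> k) = 1"
    using ex_unit_section[OF refl dim] by blast
  define Q where "Q k x = P k x - dyad (\<psi> k) x" for k x
  interpret Q: bloch_family J \<tau> \<Theta> Q m
    using bloch_family_diff_dyad[OF refl \<psi>] by (simp add: Q_def[abs_def])
  obtain \<phi> where \<phi>: "Q.symmetric_frame \<phi>" using Suc.IH[OF Q.bloch_family_axioms] by blast
  define \<phi>' where "\<phi>' a = (if a = Suc m then \<psi> else \<phi> a)" for a
  have \<phi>'_simps: "\<phi>' (Suc m) = \<psi>" "a \<in> {1..m} \<Longrightarrow> \<phi>' a = \<phi> a" for a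
    by (auto simp: \<phi>'_def)
  \<comment> \<open>The self-adjoint \<open>Q k\<close> kills \<open>\<psi> k\<close> and fixes
    every \<open>\<phi> a k\<close>; this gives orthogonality.\<close>
  have Q\<psi>: "Q k (\<psi> k) = 0" for k
    using \<psi> bloch_sectionD(1)[OF \<psi>(2)] by (simp add: Q_def dyad_self)
  have Q\<phi>: "Q k (\<phi> a k) = \<phi> a k" if "a \<in> {1..m}" for a k
    using \<phi> that Q.bloch_sectionD(1) by (auto simp: Q.symmetric_frame_def)
  have orth: "cinner J (\<psi> k) (\<phi> a k) = 0" if "a \<in> {1..m}" for a k
    using Q.P_cinner[of k "\<psi> k" "\<phi> a k"] Q\<phi>[OF that] Q\<psi> by simp
  have orth': "cinner J (\<phi> a k) (\<psi> k) = 0" if "a \<in> {1..m}" for a k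
    using orth[OF that, of k] cinner_commute[of "\<phi> a k" "\<psi> k"] by simp
  have P\<phi>: "P k (\<phi> a k) = \<phi> a k" if "a \<in> {1..m}" for a k
    using Q\<phi>[OF that, of k] orth[OF that, of k] by (simp add: Q_def dyad_def)
  have sec: "bloch_section (\<phi> a)" if "a \<in> {1..m}" for a
    using \<phi> that P\<phi>[OF that] by (auto simp: Q.symmetric_frame_def Q.bloch_section_def bloch_section_def)
  have set_eq: "{1..Suc m} = insert (Suc m) {1..m}" by auto
  have "symmetric_frame \<phi>'"
    unfolding symmetric_frame_def set_eq
  proof (intro conjI allI ballI)
    fix a assume "a \<in> insert (Suc m) {1..m}"
    then show "smooth_map (\<phi>' a)" "bloch_section (\<phi>' a)"
      using \<phi> \<psi> sec \<phi>'_simps by (auto simp: Q.symmetric_frame_def)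
  next
    fix k a b assume "a \<in> insert (Suc m) {1..m}" "b \<in> insert (Suc m) {1..m}"
    moreover have "cinner J (\<psi> k) (\<psi> k) = 1" by (simp add: cinner_self \<psi>)
    moreover have "cinner J (\<phi> a k) (\<phi> b k) = (if a = b then 1 else 0)" if "a \<in> {1..m}" "b \<in> {1..m}"
      using \<phi> that by (auto simp: Q.symmetric_frame_def)
    ultimately show "cinner J (\<phi>' a k) (\<phi>' b k) = (if a = b then 1 else 0)"
      using orth[of a k] orth'[of a k] orth[of b k] orth'[of b k] by (auto simp: \<phi>'_def)
  next
    fix k x
    have "Q k x = (\<Sum>a\<in>{1..m}. dyad (\<phi> a k) x)" using \<phi> by (auto simp: Q.symmetric_frame_def)
    moreover have "(\<Sum>a\<in>{1..m}. dyad (\<phi>' a k) x) = (\<Sum>a\<in>{1..m}. dyad (\<phi> a k) x)"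
      by (rule sum.cong) (auto simp: \<phi>'_def)
    ultimately show "P k x = (\<Sum>a\<in>insert (Suc m) {1..m}. dyad (\<phi>' a k) x)"
      by (simp add: \<phi>'_simps Q_def diff_eq_eq add.commute)
  qed
  then show ?case by blast
qed

section \<open>Transfer to a general lattice\<close>

lemma lattice_of_eq:
  fixes B :: "real^'d^'d"
  shows "lattice_of B = (\<lambda>l. B *v l) ` int_vecs"
proof -
  have "l \<in> range (\<lambda>n. \<chi> i. of_int (n i))" if "l \<in> int_vecs" for l :: "real^'d"
    using that by (intro range_eqI[of _ _ "\<lambda>i. \<lfloor>l $ i\<rfloor>"]) (auto simp: int_vecs_def vec_eq_iff elim!: Ints_cases)
  moreover have "(\<chi> i. of_int (n i)) \<in> int_vecs" for n :: "'d \<Rightarrow> int" by (simp add: int_vecs_def)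
  ultimately have eq: "int_vecs = range (\<lambda>n::'d \<Rightarrow> int. \<chi> i. real_of_int (n i))" by blast
  show ?thesis unfolding lattice_of_def eq image_image ..
qed

theorem mainTheorem1:
  fixes J :: "'h::{real_inner, complete_space} \<Rightarrow> 'h"
    and B :: "real^'d^'d"
    and P :: "real^'d \<Rightarrow> ('h \<Rightarrow>\<^sub>L 'h)"
    and \<tau> :: "real^'d \<Rightarrow> 'h \<Rightarrow> 'h"
    and \<Theta> :: "'h \<Rightarrow> 'h"
    and m :: nat
  assumes dim: "CARD('d) \<le> 3"
    and separable: "\<exists>D::'h set. countable D \<and> closure D = UNIV"
    and J: "complex_structure J"
    and lattice: "invertible B"
    and proj: "\<And>k. orth_projector J (blinfun_apply (P k))"
    and rank: "\<And>k. cdim_eq J (range (blinfun_apply (P k))) m"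
    and P1: "smooth_map P"
    and rep_unitary: "\<And>l. l \<in> lattice_of B \<Longrightarrow> unitary_op J (\<tau> l)"
    and rep_zero: "\<tau> 0 = id"
    and rep_add: "\<And>l1 l2. l1 \<in> lattice_of B \<Longrightarrow> l2 \<in> lattice_of B \<Longrightarrow>
                    \<tau> (l1 + l2) = \<tau> l1 \<circ> \<tau> l2"
    and P2: "\<And>k l. l \<in> lattice_of B \<Longrightarrow>
               blinfun_apply (P (k + l)) = \<tau> l \<circ> blinfun_apply (P k) \<circ> inv (\<tau> l)"
    and P3_anti: "antiunitary_op J \<Theta>"
    and P3: "\<And>k. blinfun_apply (P (- k)) = \<Theta> \<circ> blinfun_apply (P k) \<circ> inv \<Theta>"
    and P3_inv: "\<Theta> \<circ> \<Theta> = id"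
    and P4: "\<And>l. l \<in> lattice_of B \<Longrightarrow> \<Theta> \<circ> \<tau> l = inv (\<tau> l) \<circ> \<Theta>"
  shows "\<exists>\<phi> :: nat \<Rightarrow> real^'d \<Rightarrow> 'h.
           (\<forall>k. (\<forall>a\<in>{1..m}. \<phi> a k \<in> range (blinfun_apply (P k)))
                \<and> (\<forall>a\<in>{1..m}. \<forall>b\<in>{1..m}. cinner J (\<phi> a k) (\<phi> b k) = (if a = b then 1 else 0))
                \<and> cspan J ((\<lambda>a. \<phi> a k) ` {1..m}) = range (blinfun_apply (P k)))
         \<and> (\<forall>a\<in>{1..m}. smooth_map (\<phi> a))
         \<and> (\<forall>a\<in>{1..m}. \<forall>k. \<forall>l\<in>lattice_of B. \<phi> a (k + l) = \<tau> l (\<phi> a k))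
         \<and> (\<forall>a\<in>{1..m}. \<forall>k. \<phi> a (- k) = \<Theta> (\<phi> a k))"
proof -
  have BL: "B *v l \<in> lattice_of B" if "l \<in> int_vecs" for l using that by (simp add: lattice_of_eq)
  \<comment> \<open>The substitution of \<open>B *v k\<close> for \<open>k\<close> turns the lattice
    into \<open>int_vecs\<close> and, being linear, leaves the reflection
    \<open>k \<mapsto> -k\<close> unchanged.\<close>
  interpret time_reversal J "\<lambda>l. \<tau> (B *v l)" \<Theta>
    by unfold_locales
      (use J P3_anti P3_inv in \<open>simp_all add: rep_unitary BL rep_zero rep_add P4 matrix_vector_right_distrib\<close>)
  interpret bloch_family J "\<lambda>l. \<tau> (B *v l)" \<Theta> "\<lambda>k. blinfun_apply (P (B *v k))" m
  proof
    fix k x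
    show "orth_projector J (blinfun_apply (P (B *v k)))" by (rule proj)
    show "cdim_eq J (range (blinfun_apply (P (B *v k)))) m" by (rule rank)
    show "smooth_map (\<lambda>k. blinfun_apply (P (B *v k)) x)"
      by (rule smooth_map_bounded_linear[OF blinfun.bounded_linear_left
            smooth_map_linear_compose[OF matrix_vector_mul_linear P1]])
    have "inv \<Theta> (\<Theta> x) = x" by (rule inv_f_f) (metis injI \<Theta>_\<Theta>)
    then show "blinfun_apply (P (B *v - k)) (\<Theta> x) = \<Theta> (blinfun_apply (P (B *v k)) x)"
      using P3[of "B *v k"] by (simp add: linear_neg[OF matrix_vector_mul_linear])
    fix l :: "real^'d" assume l: "l \<in> int_vecs"
    show "blinfun_apply (P (B *v (k + l))) (\<tau> (B *v l) x) = \<tau> (B *v l) (blinfun_apply (P (B *v k)) x)"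
      using P2[OF BL[OF l], of "B *v k"] inv_\<tau>[OF l] \<tau>_minus(1)[OF l]
      by (simp add: matrix_vector_right_distrib)
  qed
  obtain \<phi> where \<phi>: "symmetric_frame \<phi>"
    using ex_symmetric_frame[OF bloch_family_axioms dim] by blast
  \<comment> \<open>The frame is carried back to the original coordinates by the inverse matrix
    \<open>A\<close>.\<close>
  obtain A where A: "B ** A = mat 1" "A ** B = mat 1" using lattice by (auto simp: invertible_def)
  have B_A: "B *v (A *v k) = k" and A_B: "A *v (B *v k) = k" for k
    using A by (simp_all add: matrix_vector_mul_assoc)
  have sec: "bloch_section (\<phi> a)" if "a \<in> {1..m}" for a
    using \<phi> that by (auto simp: symmetric_frame_def)
  have "cspan J ((\<lambda>a. \<phi> a (A *v k)) ` {1..m}) = range (blinfun_apply (P k))" for k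
  proof
    show "cspan J ((\<lambda>a. \<phi> a (A *v k)) ` {1..m}) \<subseteq> range (blinfun_apply (P k))"
      unfolding cspan_eq_span
    proof (rule C.span_minimal[OF _ subspace_range[OF proj]], safe)
      fix a assume "a \<in> {1..m}"
      then show "\<phi> a (A *v k) \<in> range (blinfun_apply (P k))"
        using bloch_sectionD(1)[OF sec, of a "A *v k"] B_A by (metis rangeI)
    qed
    have "blinfun_apply (P k) x = (\<Sum>a\<in>{1..m}. dyad (\<phi> a (A *v k)) x)" for x
      using \<phi> B_A[of k] unfolding symmetric_frame_def by metis
    then show "range (blinfun_apply (P k)) \<subseteq> cspan J ((\<lambda>a. \<phi> a (A *v k)) ` {1..m})"
      unfolding cspan_eq_span dyad_def image_subset_iff
      by (simp only:) (intro ballI C.span_sum C.span_scale C.span_base imageI)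
  qed
  moreover have "\<phi> a (A *v k) \<in> range (blinfun_apply (P k))" if "a \<in> {1..m}" for a k
    using bloch_sectionD(1)[OF sec[OF that], of "A *v k"] B_A by (metis rangeI)
  moreover have "smooth_map (\<lambda>k. \<phi> a (A *v k))" if "a \<in> {1..m}" for a
    by (rule smooth_map_linear_compose[OF matrix_vector_mul_linear]) (use \<phi> that in \<open>auto simp: symmetric_frame_def\<close>)
  moreover have "\<phi> a (A *v (k + l)) = \<tau> l (\<phi> a (A *v k))" if a: "a \<in> {1..m}" and l: "l \<in> lattice_of B" for a k l
  proof -
    obtain n where n: "n \<in> int_vecs" "l = B *v n" using l by (auto simp: lattice_of_eq)
    then show ?thesis
      using bloch_sectionD(2)[OF sec[OF a] n(1), of "A *v k"] by (simp add: matrix_vector_right_distrib A_B)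
  qed
  moreover have "\<phi> a (A *v (- k)) = \<Theta> (\<phi> a (A *v k))" if "a \<in> {1..m}" for a k
    using bloch_sectionD(3)[OF sec[OF that], of "A *v k"] by (simp add: linear_neg[OF matrix_vector_mul_linear])
  ultimately show ?thesis
    using \<phi> by (intro exI[of _ "\<lambda>a k. \<phi> a (A *v k)"]) (simp add: symmetric_frame_def)
qed

end
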